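(* In the setting described in the context, suppose Method 1 does not stop. Then the generated sequence $(x^k)_{k\in\mathbb N}$ converges weakly to some element of $\operatorname{zer}(A+B)$.
   Context: Let $\mathcal H$ be a real Hilbert space with inner product $\langle\cdot,\cdot\rangle$ and norm $\|\cdot\|$. Let $A_1:\mathcal H\to\mathcal H$ be $\beta$-cocoercive for some $\beta>0$ (i.e. $\langle A_1x-A_1y,x-y\rangle\ge\beta\|A_1x-A_1y\|^2$ for all $x,y$), let $A_2:\mathcal H\to\mathcal H$ be maximally monotone and uniformly continuous, let $B:\mathcal H\rightrightarrows\mathcal H$ be maximally monotone, and set $A:=A_1+A_2$. Assume $\operatorname{zer}(A+B):=\{x:0\in Ax+Bx\}\neq\emptyset$. $J_{\alpha B}:=(I+\alpha B)^{-1}$ for $\alpha>0$, and $P_C$ denotes the orthogonal projection onto a nonempty closed convex set $C$. Fix $\theta,\delta\in(0,1)$, $\bar\delta>0$ with $1-\delta-\bar\delta>0$, and $\alpha_{-1}>0$ with $\alpha_{-1}\le4\beta\bar\delta$. Conceptual Algorithm: pick $x^0\in\mathcal H$. Given $x^k$ and $\alpha_{k-1}$, for $j\in\mathbb N$ let $\bar x^k_j:=J_{\alpha_{k-1}\theta^jB}(x^k-\alpha_{k-1}\theta^jAx^k)$ and let $j(k)$ be the smallest $j\in\mathbb N$ with $\alpha_{k-1}\theta^j\langle A_2x^k-A_2\bar x^k_j,x^k-\bar x^k_j\rangle\le\delta\|x^k-\bar x^k_j\|^2$. Set $\alpha_k:=\alpha_{k-1}\theta^{j(k)}$, $\bar x^k:=J_{\alpha_kB}(x^k-\alpha_kAx^k)$,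 $r_k:=\frac{\bar\delta}{\alpha_k}\|x^k-\bar x^k\|^2$ and $T_k:=\{x\in\mathcal H:\langle \frac{x^k-\bar x^k}{\alpha_k}-(A_2x^k-A_2\bar x^k),x-\bar x^k\rangle\le r_k\}$. Method 1 sets $x^{k+1}:=P_{T_k}(x^k)$ and stops if $x^{k+1}=x^k$. *)

theory Defs
  imports "HOL-Analysis.Analysis"
begin

definition monotone_op :: "('a::real_inner \<Rightarrow> 'a set) \<Rightarrow> bool" where
  "monotone_op T \<longleftrightarrow>
     (\<forall>x y u v. u \<in> T x \<longrightarrow> v \<in> T y \<longrightarrow> inner (u - v) (x - y) \<ge> 0)"

definition max_monotone_op :: "('a::real_inner \<Rightarrow> 'a set) \<Rightarrow> bool" where
  "max_monotone_op T \<longleftrightarrow> monotone_op T \<and>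
     (\<forall>x u. (\<forall>y v. v \<in> T y \<longrightarrow> inner (u - v) (x - y) \<ge> 0) \<longrightarrow> u \<in> T x)"

definition cocoercive :: "real \<Rightarrow> ('a::real_inner \<Rightarrow> 'a) \<Rightarrow> bool" where
  "cocoercive \<beta> F \<longleftrightarrow>
     (\<forall>x y. inner (F x - F y) (x - y) \<ge> \<beta> * (norm (F x - F y))\<^sup>2)"

text \<open>Resolvent J_{alpha B} = (I + alpha B)^{-1}, i.e. J z is the x with z in x + alpha B x
  (single-valued with full domain for maximally monotone B and alpha > 0).\<close>
definition resolvent :: "real \<Rightarrow> ('a::real_inner \<Rightarrow> 'a set) \<Rightarrow> 'a \<Rightarrow> 'a" where
  "resolvent \<alpha> B z = (THE x. \<exists>u \<in> B x. z = x + \<alpha> *\<^sub>R u)"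

text \<open>Orthogonal projection onto a set C (nonempty closed convex in the application).\<close>
definition proj :: "'a::real_inner set \<Rightarrow> 'a \<Rightarrow> 'a" where
  "proj C z = (THE p. p \<in> C \<and> (\<forall>y \<in> C. norm (z - p) \<le> norm (z - y)))"

definition zer :: "('a \<Rightarrow> 'a::real_vector set) \<Rightarrow> 'a set" where
  "zer T = {x. 0 \<in> T x}"

definition weakly_converges_to :: "(nat \<Rightarrow> 'a::real_inner) \<Rightarrow> 'a \<Rightarrow> bool" where
  "weakly_converges_to x z \<longleftrightarrow> (\<forall>y. (\<lambda>k. inner (x k) y) \<longlonglongrightarrow> inner z y)"

text \<open>Trial point of the line search: xbar^k_j with step a = alpha_{k-1} theta^j.\<close>
definition trial_point :: "('a::real_inner \<Rightarrow> 'a) \<Rightarrow> ('a \<Rightarrow> 'a set) \<Rightarrow> real \<Rightarrow> 'a \<Rightarrow> 'a" where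
  "trial_point A B a x = resolvent a B (x - a *\<^sub>R A x)"

definition ls_index :: "('a::real_inner \<Rightarrow> 'a) \<Rightarrow> ('a \<Rightarrow> 'a) \<Rightarrow> ('a \<Rightarrow> 'a set)
    \<Rightarrow> real \<Rightarrow> real \<Rightarrow> real \<Rightarrow> 'a \<Rightarrow> nat" where
  "ls_index A A2 B \<theta> \<delta> a x = (LEAST j. let xb = trial_point A B (a * \<theta> ^ j) x in
      a * \<theta> ^ j * inner (A2 x - A2 xb) (x - xb) \<le> \<delta> * (norm (x - xb))\<^sup>2)"

text \<open>Halfspace T_k built from x = x^k, a = alpha_k.\<close>
definition halfspace_T :: "('a::real_inner \<Rightarrow> 'a) \<Rightarrow> ('a \<Rightarrow> 'a) \<Rightarrow> ('a \<Rightarrow> 'a set)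
    \<Rightarrow> real \<Rightarrow> real \<Rightarrow> 'a \<Rightarrow> 'a set" where
  "halfspace_T A A2 B \<delta>bar a x =
     (let xb = trial_point A B a x;
          r = \<delta>bar / a * (norm (x - xb))\<^sup>2
      in {y. inner ((1 / a) *\<^sub>R (x - xb) - (A2 x - A2 xb)) (y - xb) \<le> r})"

end

theory Submission
  imports Defs
begin

text \<open>
  Write \<open>b\<close> for the forward-backward point of \<open>x\<close> with step \<open>a\<close>, and \<open>x - l n\<close> for the next iterate,
  where \<open>n\<close> is the normal of the half-space. If \<open>v \<in> (A + B)(y - l v)\<close>, then with
  \<open>\<kappa> = 1 - \<delta> - \<delta>bar\<close> and \<open>c = l \<bar>x - b\<bar>\<^sup>2 / a\<close>, the squared distance between \<open>x - l n\<close> and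
  \<open>y - l v\<close> is at most \<open>\<bar>x - y\<bar>\<^sup>2 - \<kappa> c + 2 l \<langle>v, x - b\<rangle>\<close>. Taking for \<open>y\<close> a zero
  of \<open>A + B\<close> and \<open>v = 0\<close> gives Fejer monotonicity and summability of \<open>c\<close>, hence \<open>x - b \<rightarrow> 0\<close>.

  The residual \<open>\<bar>x - b\<bar> / a\<close> is small infinitely often: trivially if the step sizes stay away from 0,
  and otherwise at the iterations that reduce the step, by uniform continuity of \<open>A2\<close>. This alone
  does not control the iterations in between. There the iterates are compared with a proximal point
  trajectory of \<open>A + B\<close>, restarted at \<open>b\<close> whenever the residual is at most \<open>\<rho>\<close>. Along the trajectory the
  element \<open>v\<close> of \<open>A + B\<close> does not grow in norm, and as long as the residual exceeds \<open>\<rho>\<close> the squared distance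
  to the iterates grows by at most \<open>4 c\<close> per step. So every late iterate is close to a point where
  \<open>A + B\<close> has an element of small norm.

  Weak limits are found without weak compactness: the closed convex hulls of the tails of a bounded
  sequence have a common point, which satisfies every linear inequality that holds asymptotically
  along the sequence and is therefore a zero of the maximally monotone operator \<open>A + B\<close>.
\<close>

section \<open>Convex sets and minimization in Hilbert space\<close>

lemma Cauchy_if_dist_square_le:
  fixes p :: "nat \<Rightarrow> 'a::real_normed_vector"
  assumes le: "\<And>m n. n \<le> m \<Longrightarrow> (norm (p n - p m))\<^sup>2 \<le> e n + e m"
    and e: "e \<longlonglongrightarrow> 0"
  shows "Cauchy p"
proof (rule metric_CauchyI)
  fix r :: real assume r: "0 < r"
  have "eventually (\<lambda>n. e n < r\<^sup>2 / 2) sequentially"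
    using order_tendstoD(2)[OF e, of "r\<^sup>2 / 2"] r by simp
  then obtain M where M: "\<And>n. n \<ge> M \<Longrightarrow> e n < r\<^sup>2 / 2"
    by (auto simp: eventually_sequentially)
  have "norm (p n - p m) < r" if "n \<le> m" "n \<ge> M" for m n
  proof -
    have "(norm (p n - p m))\<^sup>2 < r\<^sup>2"
      using le[OF that(1)] M[of n] M[of m] that by simp
    then show ?thesis using r by (simp add: power_less_imp_less_base)
  qed
  then have "dist (p m) (p n) < r" if "m \<ge> M" "n \<ge> M" for m n
    using that nat_le_linear[of m n] by (metis dist_norm dist_commute)
  then show "\<exists>M. \<forall>m\<ge>M. \<forall>n\<ge>M. dist (p m) (p n) < r" by blast
qed

lemma norm_midpoint_square:
  fixes p q :: "'a::real_inner"
  shows "(norm ((1/2) *\<^sub>R p + (1/2) *\<^sub>R q))\<^sup>2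
    = (norm p)\<^sup>2 / 2 + (norm q)\<^sup>2 / 2 - (norm (p - q))\<^sup>2 / 4"
  unfolding power2_norm_eq_inner
  by (simp add: inner_add_left inner_add_right inner_diff_left inner_diff_right
      inner_commute field_simps)

text \<open>The minimal squared norms \<open>d n\<close> over \<open>C n\<close> increase and stay
  bounded, so they converge. Almost minimal points \<open>p n\<close> are then Cauchy by the
  midpoint identity, since the midpoint of \<open>p n\<close> and \<open>p m\<close> lies in the
  larger set \<open>C n\<close>. Their limit is the common point.\<close>

lemma nested_closed_convex_Inter_nonempty:
  fixes C :: "nat \<Rightarrow> 'a::{real_inner, complete_space} set"
  assumes cl: "\<And>n. closed (C n)" and cv: "\<And>n. convex (C n)" and ne: "\<And>n. C n \<noteq> {}"
    and dec: "\<And>m n. n \<le> m \<Longrightarrow> C m \<subseteq> C n" and bd: "bounded (C 0)"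
  shows "\<exists>w. \<forall>n. w \<in> C n"
proof -
  define d where "d n = (INF p\<in>C n. (norm p)\<^sup>2)" for n
  obtain M where M: "\<And>p. p \<in> C 0 \<Longrightarrow> norm p \<le> M" using bd by (auto simp: bounded_iff)
  have bb: "bdd_below ((\<lambda>p. (norm p)\<^sup>2) ` C n)" for n
    by (rule bdd_belowI[of _ 0]) auto
  have dle: "d n \<le> (norm p)\<^sup>2" if "p \<in> C n" for p n
    unfolding d_def using that bb by (intro cINF_lower) auto
  have "\<exists>p\<in>C n. (norm p)\<^sup>2 < d n + inverse (real (Suc n))" for n
    using cINF_less_iff[OF ne bb, of n "d n + inverse (real (Suc n))"] unfolding d_def by simp
  then obtain p where p: "\<And>n. p n \<in> C n" "\<And>n. (norm (p n))\<^sup>2 < d n + inverse (real (Suc n))"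
    by metis
  have dmono: "d n \<le> d m" if "n \<le> m" for n m
    unfolding d_def using dec[OF that] ne bb by (intro cINF_superset_mono) auto
  have "d n \<le> M\<^sup>2" for n
  proof -
    have "norm (p n) \<le> M" using M dec[of 0 n] p(1) by blast
    then have "(norm (p n))\<^sup>2 \<le> M\<^sup>2" by (intro power_mono) auto
    then show ?thesis using dle[OF p(1), of n] by linarith
  qed
  then obtain D where D: "d \<longlonglongrightarrow> D" "\<And>n. d n \<le> D"
    using incseq_convergent[of d] dmono by (auto simp: incseq_def)
  define e where "e n = 2 * (D - d n) + 2 * inverse (real (Suc n))" for n
  have e0: "e \<longlonglongrightarrow> 0"
    unfolding e_def
    using tendsto_add[OF tendsto_mult[OF tendsto_const[of 2] tendsto_diff[OF tendsto_const[of D] D(1)]]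
        tendsto_mult[OF tendsto_const[of 2] LIMSEQ_inverse_real_of_nat]] by simp
  have "Cauchy p"
  proof (rule Cauchy_if_dist_square_le[OF _ e0])
    fix n m :: nat assume nm: "n \<le> m"
    have "(1/2) *\<^sub>R p n + (1/2) *\<^sub>R p m \<in> C n"
      using convexD[OF cv p(1), of "p m" n "1/2" "1/2"] dec[OF nm] p(1) by auto
    from dle[OF this] norm_midpoint_square[of "p n" "p m"]
    have "(norm (p n - p m))\<^sup>2 \<le> 2 * (norm (p n))\<^sup>2 + 2 * (norm (p m))\<^sup>2 - 4 * d n" by simp
    then show "(norm (p n - p m))\<^sup>2 \<le> e n + e m"
      unfolding e_def using p(2)[of n] p(2)[of m] D(2)[of m] D(2)[of n] dmono[OF nm] by simp
  qed
  then obtain w where w: "p \<longlonglongrightarrow> w" using Cauchy_convergent convergent_def by blast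
  have "w \<in> C n" for n
  proof (rule Lim_in_closed_set[OF cl _ _ w])
    show "eventually (\<lambda>k. p k \<in> C n) sequentially"
      unfolding eventually_sequentially using dec p(1) by blast
  qed simp
  then show ?thesis by blast
qed

text \<open>The objective \<open>f\<close> is strongly convex in the first component only. That
  makes the first components of a minimizing sequence Cauchy; the second ones converge because they
  equal \<open>f\<close> minus half the squared norm.\<close>

lemma exists_quadratic_minimizer:
  fixes E :: "('b::{real_inner, complete_space} \<times> real) set"
  assumes cl: "closed E" and cv: "convex E" and ne: "E \<noteq> {}"
    and bd: "\<And>p t. (p, t) \<in> E \<Longrightarrow> b \<le> t + (norm p)\<^sup>2 / 2"
  obtains p0 t0 where "(p0, t0) \<in> E"
    "\<And>p t. (p, t) \<in> E \<Longrightarrow> t0 + (norm p0)\<^sup>2 / 2 \<le> t + (norm p)\<^sup>2 / 2"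
proof -
  define f where "f e = snd e + (norm (fst e))\<^sup>2 / 2" for e :: "'b \<times> real"
  define m where "m = (INF e\<in>E. f e)"
  have bb: "bdd_below (f ` E)"
    by (rule bdd_belowI[of _ b]) (use bd in \<open>auto simp: f_def\<close>)
  have mle: "m \<le> f e" if "e \<in> E" for e
    unfolding m_def using that bb by (intro cINF_lower) auto
  have "\<exists>e\<in>E. f e < m + inverse (real (Suc n))" for n
    using cINF_less_iff[OF ne bb, of "m + inverse (real (Suc n))"] unfolding m_def by simp
  then obtain e where e: "\<And>n. e n \<in> E" "\<And>n. f (e n) < m + inverse (real (Suc n))" by metis
  have "Cauchy (\<lambda>n. fst (e n))"
  proof (rule Cauchy_if_dist_square_le[where e = "\<lambda>n. 4 * inverse (real (Suc n))"])
    show "(\<lambda>n. 4 * inverse (real (Suc n))) \<longlonglongrightarrow> 0"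
      using tendsto_mult[OF tendsto_const[of 4] LIMSEQ_inverse_real_of_nat] by simp
    fix n k :: nat
    have "(1/2) *\<^sub>R e n + (1/2) *\<^sub>R e k \<in> E" using convexD[OF cv e(1) e(1), of "1/2" "1/2"] by simp
    from mle[OF this] have "m \<le> snd (e n) / 2 + snd (e k) / 2
        + (norm ((1/2) *\<^sub>R fst (e n) + (1/2) *\<^sub>R fst (e k)))\<^sup>2 / 2"
      by (simp add: f_def)
    then show "(norm (fst (e n) - fst (e k)))\<^sup>2
        \<le> 4 * inverse (real (Suc n)) + 4 * inverse (real (Suc k))"
      using e(2)[of n] e(2)[of k] unfolding norm_midpoint_square f_def by argo
  qed
  then obtain p0 where p0: "(\<lambda>n. fst (e n)) \<longlonglongrightarrow> p0" using Cauchy_convergent convergent_def by blast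
  have fm: "(\<lambda>n. f (e n)) \<longlonglongrightarrow> m"
  proof (rule tendsto_sandwich[of "\<lambda>_. m" _ _ "\<lambda>n. m + inverse (real (Suc n))"])
    show "(\<lambda>n. m + inverse (real (Suc n))) \<longlonglongrightarrow> m"
      using tendsto_add[OF tendsto_const[of m] LIMSEQ_inverse_real_of_nat] by simp
  qed (use mle e in \<open>auto intro!: always_eventually less_imp_le\<close>)
  have "(\<lambda>n. f (e n) - (norm (fst (e n)))\<^sup>2 / 2) \<longlonglongrightarrow> m - (norm p0)\<^sup>2 / 2"
    by (intro tendsto_intros fm p0) simp
  then have "(\<lambda>n. snd (e n)) \<longlonglongrightarrow> m - (norm p0)\<^sup>2 / 2" by (simp add: f_def)
  then have "(\<lambda>n. (fst (e n), snd (e n))) \<longlonglongrightarrow> (p0, m - (norm p0)\<^sup>2 / 2)"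
    by (intro tendsto_Pair p0)
  then have "(p0, m - (norm p0)\<^sup>2 / 2) \<in> E"
    using closed_sequentially[OF cl, of e] e(1) by simp
  then show thesis
    by (rule that) (use mle in \<open>force simp: f_def\<close>)
qed

text \<open>First-order optimality: the minimizer is compared with the points of the segment towards
  \<open>(p, t)\<close>. After division by the parameter \<open>s\<close>, the quadratic remainder
  vanishes as \<open>s\<close> tends to 0.\<close>

lemma exists_quadratic_variational_point:
  fixes E :: "('b::{real_inner, complete_space} \<times> real) set"
  assumes cl: "closed E" and cv: "convex E" and ne: "E \<noteq> {}"
    and bd: "\<And>p t. (p, t) \<in> E \<Longrightarrow> b \<le> t + (norm p)\<^sup>2 / 2"
  obtains p0 t0 where "(p0, t0) \<in> E"
    "\<And>p t. (p, t) \<in> E \<Longrightarrow> t0 - t \<le> inner p0 (p - p0)"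
proof -
  obtain p0 t0 where p0: "(p0, t0) \<in> E"
    and min: "\<And>p t. (p, t) \<in> E \<Longrightarrow> t0 + (norm p0)\<^sup>2 / 2 \<le> t + (norm p)\<^sup>2 / 2"
    using exists_quadratic_minimizer[OF cl cv ne bd] by metis
  have "t0 - t \<le> inner p0 (p - p0)" if pt: "(p, t) \<in> E" for p t
  proof (rule tendsto_le[where F = "at_right 0"])
    show "((\<lambda>s. inner p0 (p - p0) + s * (norm (p - p0))\<^sup>2 / 2) \<longlongrightarrow> inner p0 (p - p0)) (at_right 0)"
      by (auto intro!: tendsto_eq_intros)
    show "((\<lambda>s::real. t0 - t) \<longlongrightarrow> t0 - t) (at_right 0)" by simp
    have "t0 - t \<le> inner p0 (p - p0) + s * (norm (p - p0))\<^sup>2 / 2" if s: "0 < s" "s < 1" for s :: real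
    proof -
      have "(1 - s) *\<^sub>R (p0, t0) + s *\<^sub>R (p, t) \<in> E"
        using convexD[OF cv p0 pt, of "1 - s" s] s by simp
      moreover have "(1 - s) *\<^sub>R (p0, t0) + s *\<^sub>R (p, t) = (p0 + s *\<^sub>R (p - p0), t0 + s * (t - t0))"
        by (simp add: algebra_simps)
      ultimately have "(p0 + s *\<^sub>R (p - p0), t0 + s * (t - t0)) \<in> E" by simp
      from min[OF this] have "0 \<le> s * (t - t0) + (2 * s * inner p0 (p - p0) + s\<^sup>2 * (norm (p - p0))\<^sup>2) / 2"
        unfolding power2_norm_eq_inner
        by (simp add: inner_add_left inner_add_right inner_commute power2_eq_square add_divide_distrib)
      also have "\<dots> = s * (t - t0 + inner p0 (p - p0) + s * (norm (p - p0))\<^sup>2 / 2)"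
        by (simp add: power2_eq_square field_simps inner_diff_right)
      finally show ?thesis using s(1) by (simp add: zero_le_mult_iff)
    qed
    then show "eventually (\<lambda>s. t0 - t \<le> inner p0 (p - p0) + s * (norm (p - p0))\<^sup>2 / 2) (at_right 0)"
      unfolding eventually_at_right_field by (intro exI[of _ 1]) auto
  qed simp
  then show thesis using that p0 by blast
qed

section \<open>Maximally monotone operators\<close>

text \<open>Minty's theorem. The set \<open>E\<close> below is the epigraph of the Fitzpatrick function, which dominates
  the duality pairing and coincides with it on the graph of \<open>T\<close>.\<close>
lemma max_monotone_op_negation_in_range:
  fixes T :: "'a::{real_inner, complete_space} \<Rightarrow> 'a set"
  assumes T: "max_monotone_op T"
  shows "\<exists>x. - x \<in> T x"
proof -
  have mono: "\<And>x y u v. u \<in> T x \<Longrightarrow> v \<in> T y \<Longrightarrow> inner (u - v) (x - y) \<ge> 0"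
    and maxi: "\<And>x u. (\<And>y v. v \<in> T y \<Longrightarrow> inner (u - v) (x - y) \<ge> 0) \<Longrightarrow> u \<in> T x"
    using T unfolding max_monotone_op_def monotone_op_def by blast+
  define E :: "(('a \<times> 'a) \<times> real) set" where
    "E = {q. \<forall>y v. v \<in> T y \<longrightarrow>
       inner (fst (fst q)) v + inner y (snd (fst q)) - inner y v \<le> snd q}"
  have inE: "((y, v), inner y v) \<in> E" if "v \<in> T y" for y v
  proof -
    have "inner y v' + inner y' v - inner y' v' \<le> inner y v" if "v' \<in> T y'" for y' v'
      using mono[OF \<open>v \<in> T y\<close> that] by (simp add: inner_diff_left inner_diff_right inner_commute)
    then show ?thesis unfolding E_def by simp
  qed
  have ge: "inner y v \<le> t" if "((y, v), t) \<in> E" for y v t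
  proof (cases "v \<in> T y")
    case True
    then show ?thesis using that unfolding E_def by fastforce
  next
    case False
    then obtain y' v' where "v' \<in> T y'" "inner (v - v') (y - y') < 0"
      using maxi[of v y] by (meson not_le)
    moreover from this(1) have "inner y v' + inner y' v - inner y' v' \<le> t"
      using that unfolding E_def by simp
    ultimately show ?thesis
      by (simp add: inner_diff_left inner_diff_right inner_commute)
  qed
  have "closed E"
    unfolding E_def
    by (intro closed_Collect_all closed_Collect_imp closed_Collect_le continuous_intros) auto
  moreover have "convex E"
  proof (rule convexI)
    fix q q' :: "('a \<times> 'a) \<times> real" and s s' :: real
    assume q: "q \<in> E" "q' \<in> E" and s: "0 \<le> s" "0 \<le> s'" "s + s' = 1"
    show "s *\<^sub>R q + s' *\<^sub>R q' \<in> E"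
      unfolding E_def
    proof (clarsimp simp: inner_add_left inner_add_right)
      fix y v assume v: "v \<in> T y"
      have 1: "s * (inner (fst (fst q)) v + inner y (snd (fst q)) - inner y v) \<le> s * snd q"
        using q v s unfolding E_def by (intro mult_left_mono) auto
      have 2: "s' * (inner (fst (fst q')) v + inner y (snd (fst q')) - inner y v) \<le> s' * snd q'"
        using q v s unfolding E_def by (intro mult_left_mono) auto
      have "inner y v = s * inner y v + s' * inner y v"
        using s(3) by (metis distrib_right mult_1)
      then show "s * inner (fst (fst q)) v + s' * inner (fst (fst q')) v +
           (s * inner y (snd (fst q)) + s' * inner y (snd (fst q'))) - inner y v
           \<le> s * snd q + s' * snd q'"
        using 1 2 by (simp add: algebra_simps)
    qed
  qed
  moreover have "E \<noteq> {}"
    using inE maxi by fastforce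
  \<comment> \<open>On \<open>E\<close> the value \<open>t\<close> is at least
    \<open>inner y v\<close>, so the expression dominates half the squared norm of
    \<open>y + v\<close>.\<close>
  moreover have "0 \<le> t + (norm p)\<^sup>2 / 2" if "(p, t) \<in> E" for p t
  proof -
    obtain y v where p: "p = (y, v)" by fastforce
    have "0 \<le> inner (y + v) (y + v)" by simp
    then show ?thesis using ge[of y v t] that unfolding p power2_norm_eq_inner
      by (simp add: inner_add_left inner_add_right inner_commute inner_Pair field_simps)
  qed
  ultimately obtain p0 t0 where p0: "(p0, t0) \<in> E"
    and var: "\<And>p t. (p, t) \<in> E \<Longrightarrow> t0 - t \<le> inner p0 (p - p0)"
    using exists_quadratic_variational_point[of E 0] by metis
  obtain x u where xu: "p0 = (x, u)" by fastforce
  \<comment> \<open>The variational inequality at the graph point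
    \<open>((y, v), inner y v)\<close>, with \<open>t0\<close> bounded below by
    \<open>inner x u\<close>. It makes \<open>(- u, - x)\<close> monotonically related to the whole
    graph, hence a member by maximality; inserting this very point leaves 0 on the right.\<close>
  have key: "inner (x + u) (x + u) \<le> inner (- x - v) (- u - y)" if v: "v \<in> T y" for y v
    using var[OF inE[OF v]] ge[of x u t0] p0 unfolding xu
    by (simp add: inner_add_left inner_add_right inner_diff_left inner_diff_right inner_commute
        inner_Pair)
  have "- x \<in> T (- u)"
    using key by (intro maxi) (meson inner_ge_zero order_trans)
  from key[OF this] have "inner (x + u) (x + u) \<le> 0" by simp
  then have "x + u = 0" by (metis inner_gt_zero_iff not_less)
  then have "- u = x" by (metis add.commute minus_unique)
  then show ?thesis using \<open>- x \<in> T (- u)\<close> by auto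
qed

text \<open>Minty's theorem applied to the scaled and shifted operator \<open>T'\<close>:
  \<open>- x \<in> T' x\<close> unfolds to the resolvent equation.\<close>

lemma resolvent_exists:
  fixes T :: "'a::{real_inner, complete_space} \<Rightarrow> 'a set"
  assumes T: "max_monotone_op T" and a: "a > 0"
  shows "\<exists>x u. u \<in> T x \<and> z = x + a *\<^sub>R u"
proof -
  define T' where "T' x = {a *\<^sub>R u - z | u. u \<in> T x}" for x
  have mono: "\<And>x y u v. u \<in> T x \<Longrightarrow> v \<in> T y \<Longrightarrow> inner (u - v) (x - y) \<ge> 0"
    and maxi: "\<And>x u. (\<And>y v. v \<in> T y \<Longrightarrow> inner (u - v) (x - y) \<ge> 0) \<Longrightarrow> u \<in> T x"
    using T unfolding max_monotone_op_def monotone_op_def by blast+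
  have "max_monotone_op T'"
    unfolding max_monotone_op_def monotone_op_def
  proof (intro conjI allI impI)
    fix x y u v assume "u \<in> T' x" "v \<in> T' y"
    then obtain u' v' where *: "u' \<in> T x" "v' \<in> T y" "u = a *\<^sub>R u' - z" "v = a *\<^sub>R v' - z"
      unfolding T'_def by auto
    have "u - v = a *\<^sub>R (u' - v')" unfolding *(3,4) by (simp add: scaleR_diff_right)
    then show "inner (u - v) (x - y) \<ge> 0" using mono[OF *(1,2)] a by simp
  next
    fix x u assume *: "\<forall>y v. v \<in> T' y \<longrightarrow> 0 \<le> inner (u - v) (x - y)"
    have "(1/a) *\<^sub>R (u + z) \<in> T x"
    proof (rule maxi)
      fix y v assume "v \<in> T y"
      then have "0 \<le> inner (u - (a *\<^sub>R v - z)) (x - y)" using * unfolding T'_def by blast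
      moreover have "u - (a *\<^sub>R v - z) = a *\<^sub>R ((1/a) *\<^sub>R (u + z) - v)"
        using a by (simp add: algebra_simps)
      ultimately show "0 \<le> inner ((1/a) *\<^sub>R (u + z) - v) (x - y)"
        using a by (simp add: zero_le_mult_iff)
    qed
    moreover have "u = a *\<^sub>R ((1/a) *\<^sub>R (u + z)) - z" using a by simp
    ultimately show "u \<in> T' x" unfolding T'_def by blast
  qed
  then obtain x where "- x \<in> T' x" using max_monotone_op_negation_in_range by blast
  then obtain u where u: "u \<in> T x" "- x = a *\<^sub>R u - z" unfolding T'_def by auto
  from u(2) have "z = x + a *\<^sub>R u" by (simp add: algebra_simps)
  with u(1) show ?thesis by blast
qed

lemma resolvent_unique:
  fixes T :: "'a::real_inner \<Rightarrow> 'a set"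
  assumes T: "monotone_op T" and a: "a > 0"
    and u: "u \<in> T x" and v: "v \<in> T y" and eq: "x + a *\<^sub>R u = y + a *\<^sub>R v"
  shows "x = y"
proof -
  have "x - y = - a *\<^sub>R (u - v)" using eq by (simp add: algebra_simps)
  moreover have "0 \<le> inner (u - v) (x - y)"
    using T u v unfolding monotone_op_def by blast
  ultimately have "0 \<le> inner (u - v) (- a *\<^sub>R (u - v))" by simp
  then have "inner (u - v) (u - v) \<le> 0" using a by (simp add: mult_le_0_iff)
  then have "u = v" by (metis inner_gt_zero_iff not_less right_minus_eq)
  with eq show ?thesis by simp
qed

lemma resolvent_eq:
  fixes T :: "'a::real_inner \<Rightarrow> 'a set"
  assumes "monotone_op T" "a > 0" "u \<in> T x" "z = x + a *\<^sub>R u"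
  shows "resolvent a T z = x"
  unfolding resolvent_def
  by (rule the_equality) (use assms resolvent_unique in \<open>blast+\<close>)

lemma resolvent_in:
  fixes T :: "'a::{real_inner, complete_space} \<Rightarrow> 'a set"
  assumes T: "max_monotone_op T" and a: "a > 0"
  shows "(1/a) *\<^sub>R (z - resolvent a T z) \<in> T (resolvent a T z)"
proof -
  obtain x u where xu: "u \<in> T x" "z = x + a *\<^sub>R u" using resolvent_exists[OF T a] by blast
  have "resolvent a T z = x"
    by (rule resolvent_eq[where u = u]) (use T a xu in \<open>auto simp: max_monotone_op_def\<close>)
  then show ?thesis using xu a by simp
qed

lemma max_monotone_op_graph_closed:
  fixes T :: "'a::real_inner \<Rightarrow> 'a set"
  assumes T: "max_monotone_op T" and u: "\<And>n. u n \<in> T (x n)"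
    and lim: "x \<longlonglongrightarrow> x0" "u \<longlonglongrightarrow> u0"
  shows "u0 \<in> T x0"
proof -
  have "0 \<le> inner (u0 - v) (x0 - y)" if v: "v \<in> T y" for y v
  proof (rule LIMSEQ_le_const)
    show "(\<lambda>n. inner (u n - v) (x n - y)) \<longlonglongrightarrow> inner (u0 - v) (x0 - y)"
      by (intro tendsto_intros lim)
    show "\<exists>N. \<forall>n\<ge>N. 0 \<le> inner (u n - v) (x n - y)"
      using T u v unfolding max_monotone_op_def monotone_op_def by blast
  qed
  then show ?thesis using T unfolding max_monotone_op_def by blast
qed

text \<open>A replacement for a Lipschitz bound: the segment from \<open>y\<close> to
  \<open>x\<close> is cut into \<open>N\<close> pieces shorter than \<open>d\<close>, and each piece
  changes \<open>F\<close> by less than 1.\<close>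

lemma uniformly_continuous_linear_growth:
  fixes F :: "'a::real_normed_vector \<Rightarrow> 'b::real_normed_vector"
  assumes "uniformly_continuous_on UNIV F"
  obtains L where "L \<ge> 0" "\<And>x y. norm (F x - F y) \<le> 1 + L * norm (x - y)"
proof -
  obtain d where d: "d > 0" "\<And>x y. dist x y < d \<Longrightarrow> dist (F x) (F y) < 1"
    using assms unfolding uniformly_continuous_on_def by (metis UNIV_I zero_less_one)
  have "norm (F x - F y) \<le> 1 + (1/d) * norm (x - y)" for x y
  proof -
    define N where "N = nat \<lfloor>norm (x - y) / d\<rfloor> + 1"
    have N: "norm (x - y) / d < real N" "real N \<le> 1 + norm (x - y) / d" "N > 0"
      unfolding N_def using d(1) by (auto simp: of_nat_nat) linarith+
    define p where "p i = y + (real i / real N) *\<^sub>R (x - y)" for i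
    have "norm (F (p i) - F y) \<le> real i" for i
    proof (induction i)
      case (Suc i)
      have "p (Suc i) - p i = (1 / real N) *\<^sub>R (x - y)"
        unfolding p_def by (simp add: scaleR_diff_left[symmetric] diff_divide_distrib[symmetric])
      then have "norm (p (Suc i) - p i) = norm (x - y) / real N" by simp
      moreover have "norm (x - y) / real N < d" using N d(1) by (simp add: field_simps)
      ultimately have "dist (p (Suc i)) (p i) < d" by (simp add: dist_norm)
      then have "norm (F (p (Suc i)) - F (p i)) < 1" using d(2) by (simp add: dist_norm)
      then show ?case
        using Suc norm_triangle_ineq[of "F (p (Suc i)) - F (p i)" "F (p i) - F y"] by simp
    qed (simp add: p_def)
    from this[of N] have "norm (F x - F y) \<le> real N" using N(3) by (simp add: p_def)
    then show ?thesis using N(2) by simp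
  qed
  then show thesis using that[of "1/d"] d(1) by simp
qed

text \<open>As soon as \<open>t n * L < 1/2\<close>, the term with \<open>norm (q n)\<close> on the
  right is absorbed on the left.\<close>

lemma norm_tendsto_zero_if_le_growth:
  fixes q :: "nat \<Rightarrow> 'a::real_normed_vector"
  assumes le: "\<And>n. norm (q n) \<le> t n * (1 + L * norm (q n))" and t: "t \<longlonglongrightarrow> 0" "\<And>n. t n \<ge> 0"
    and L: "L \<ge> 0"
  shows "q \<longlonglongrightarrow> 0"
proof -
  have "(\<lambda>n. t n * L) \<longlonglongrightarrow> 0 * L" by (intro tendsto_intros t)
  then have "eventually (\<lambda>n. t n * L < 1/2) sequentially"
    by (intro order_tendstoD(2)) auto
  then have "eventually (\<lambda>n. norm (q n) \<le> 2 * t n) sequentially"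
  proof eventually_elim
    case (elim n)
    have "t n * L * norm (q n) \<le> 1/2 * norm (q n)" using elim by (intro mult_right_mono) auto
    then show ?case using le[of n] by (simp add: algebra_simps)
  qed
  then show ?thesis
  proof (rule Lim_null_comparison)
    show "(\<lambda>n. 2 * t n) \<longlonglongrightarrow> 0" using tendsto_mult[OF tendsto_const[of 2] t(1)] by simp
  qed
qed

lemma uniformly_continuous_diff_tendsto_zero:
  fixes F :: "'a::real_normed_vector \<Rightarrow> 'b::real_normed_vector"
  assumes F: "uniformly_continuous_on UNIV F" and d: "(\<lambda>n. x n - y n) \<longlonglongrightarrow> (0::'a)"
  shows "(\<lambda>n. F (x n) - F (y n)) \<longlonglongrightarrow> 0"
proof -
  have "(\<lambda>n. dist (F (x n)) (F (y n))) \<longlonglongrightarrow> 0"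
    using F d unfolding uniformly_continuous_on_sequentially
    by (auto simp: dist_norm tendsto_norm_zero)
  then show ?thesis by (simp add: dist_norm tendsto_norm_zero_cancel)
qed

text \<open>For a pair \<open>(w, u)\<close> monotonically related to the sum, resolvents of
  \<open>B\<close> with steps \<open>t n\<close> tending to 0 produce graph points
  \<open>(y n, b n)\<close> of \<open>B\<close> that converge to \<open>(w, u - A w)\<close>. The
  graph of \<open>B\<close> is closed.\<close>

lemma max_monotone_op_add_uniformly_continuous:
  fixes A :: "'a::{real_inner, complete_space} \<Rightarrow> 'a"
  assumes mA: "\<And>x y. inner (A x - A y) (x - y) \<ge> 0"
    and uA: "uniformly_continuous_on UNIV A" and B: "max_monotone_op B"
  shows "max_monotone_op (\<lambda>z. {A z} + B z)"
proof -
  have mono: "\<And>x y u v. u \<in> B x \<Longrightarrow> v \<in> B y \<Longrightarrow> inner (u - v) (x - y) \<ge> 0"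
    using B unfolding max_monotone_op_def monotone_op_def by blast
  obtain L where L: "L \<ge> 0" "\<And>x y. norm (A x - A y) \<le> 1 + L * norm (x - y)"
    using uniformly_continuous_linear_growth[OF uA] by metis
  show ?thesis
    unfolding max_monotone_op_def monotone_op_def
  proof (intro conjI allI impI)
    fix x y u v assume "u \<in> {A x} + B x" "v \<in> {A y} + B y"
    then obtain u' v' where "u = A x + u'" "u' \<in> B x" "v = A y + v'" "v' \<in> B y"
      by (auto elim!: set_plus_elim)
    then show "inner (u - v) (x - y) \<ge> 0"
      using mono[of u' x v' y] mA[of x y] by (simp add: inner_add_left inner_diff_left)
  next
    fix w u assume *: "\<forall>y v. v \<in> {A y} + B y \<longrightarrow> 0 \<le> inner (u - v) (w - y)"
    define t where "t n = inverse (real (Suc n))" for n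
    have t: "t n > 0" "t \<longlonglongrightarrow> 0" for n
      unfolding t_def using LIMSEQ_inverse_real_of_nat by auto
    define z where "z n = w + t n *\<^sub>R (u - A w)" for n
    define y where "y n = resolvent (t n) B (z n)" for n
    define b where "b n = (1 / t n) *\<^sub>R (z n - y n)" for n
    have b: "b n \<in> B (y n)" for n
      unfolding b_def y_def by (rule resolvent_in[OF B t(1)])
    have b_eq: "b n = (1 / t n) *\<^sub>R (w - y n) + (u - A w)" for n
      unfolding b_def z_def using t(1)[of n] by (simp add: algebra_simps)
    \<comment> \<open>Testing the relation at \<open>y n\<close> bounds the displacement by
      \<open>t n\<close> times the change of \<open>A\<close>. Linear growth makes the displacement
      vanish; uniform continuity then makes the change of \<open>A\<close> vanish, and with it the
      displacement divided by \<open>t n\<close>.\<close>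
    have le: "norm (w - y n) \<le> t n * norm (A w - A (y n))" for n
    proof -
      have "0 \<le> inner (u - (A (y n) + b n)) (w - y n)"
        using * b by (meson set_plus_intro singletonI)
      also have "u - (A (y n) + b n) = (A w - A (y n)) - (1 / t n) *\<^sub>R (w - y n)"
        unfolding b_eq by (simp add: algebra_simps)
      finally have "(norm (w - y n))\<^sup>2 / t n \<le> inner (A w - A (y n)) (w - y n)"
        by (simp add: inner_diff_left power2_norm_eq_inner)
      also have "\<dots> \<le> norm (A w - A (y n)) * norm (w - y n)" by (rule norm_cauchy_schwarz)
      finally show ?thesis
        using t(1)[of n] by (cases "w = y n") (simp_all add: field_simps power2_eq_square)
    qed
    have 0: "(\<lambda>n. w - y n) \<longlonglongrightarrow> 0"
    proof (rule norm_tendsto_zero_if_le_growth[OF _ t(2) _ L(1)])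
      fix n show "norm (w - y n) \<le> t n * (1 + L * norm (w - y n))"
        using le[of n] mult_left_mono[OF L(2)[of w "y n"], of "t n"] t(1)[of n] by linarith
    qed (use t less_imp_le in blast)
    have "(\<lambda>n. A w - A (y n)) \<longlonglongrightarrow> 0"
      by (rule uniformly_continuous_diff_tendsto_zero[OF uA 0])
    then have "(\<lambda>n. (1 / t n) *\<^sub>R (w - y n)) \<longlonglongrightarrow> 0"
    proof (rule Lim_null_comparison[OF _ tendsto_norm_zero, rotated])
      show "\<forall>\<^sub>F n in sequentially. norm ((1 / t n) *\<^sub>R (w - y n)) \<le> norm (A w - A (y n))"
        using le t(1) by (auto intro!: always_eventually simp: abs_of_pos pos_divide_le_eq mult.commute)
    qed
    then have "b \<longlonglongrightarrow> 0 + (u - A w)" unfolding b_eq by (intro tendsto_intros)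
    moreover have "y \<longlonglongrightarrow> w" using tendsto_diff[OF tendsto_const[of w] 0] by simp
    ultimately have "u - A w \<in> B w" using max_monotone_op_graph_closed[OF B b] by simp
    then have "A w + (u - A w) \<in> {A w} + B w" by blast
    then show "u \<in> {A w} + B w" by simp
  qed
qed

section \<open>Weak convergence of Fejer monotone sequences\<close>

text \<open>Opial's argument, with common points of the closed tail hulls of a subsequence in the
  role of weak cluster points.\<close>

lemma weakly_converges_by_tail_hulls:
  fixes x :: "nat \<Rightarrow> 'a::{real_inner, complete_space}"
  assumes ne: "S \<noteq> {}"
    and fejer: "\<And>z. z \<in> S \<Longrightarrow> convergent (\<lambda>k. norm (x k - z))"
    and cluster: "\<And>r w. strict_mono (r :: nat \<Rightarrow> nat) \<Longrightarrow>
       (\<And>n. w \<in> closure (convex hull ((\<lambda>k. x (r k)) ` {n..}))) \<Longrightarrow> w \<in> S"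
  shows "\<exists>z\<in>S. weakly_converges_to x z"
proof -
  define C where "C r n = closure (convex hull ((\<lambda>k. x (r k)) ` {n..}))" for r :: "nat \<Rightarrow> nat" and n
  have half: "C r n \<subseteq> {w. inner y w \<le> b}" if "\<And>k. k \<ge> n \<Longrightarrow> inner y (x (r k)) \<le> b" for r n y b
    unfolding C_def
    by (intro closure_minimal hull_minimal closed_halfspace_le convex_halfspace_le) (use that in auto)
  obtain z0 where z0: "z0 \<in> S" using ne by blast
  obtain M where M: "\<And>k. norm (x k) \<le> M"
  proof -
    obtain M where "\<And>k. norm (norm (x k - z0)) \<le> M"
      using convergent_imp_Bseq[OF fejer[OF z0]] unfolding Bseq_def by blast
    then have "norm (x k) \<le> M + norm z0" for k
      using norm_triangle_ineq[of "x k - z0" z0] by (smt (verit) diff_add_cancel norm_ge_zero real_norm_def)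
    then show thesis using that by blast
  qed
  have point: "\<exists>w\<in>S. \<forall>n. w \<in> C r n" if r: "strict_mono r" for r
  proof -
    have "C r 0 \<subseteq> cball 0 M"
      unfolding C_def by (intro closure_minimal hull_minimal) (use M in auto)
    then have "bounded (C r 0)" by (rule bounded_subset[OF bounded_cball])
    moreover have "C r m \<subseteq> C r n" if "n \<le> m" for m n
      unfolding C_def using that by (intro closure_mono hull_mono image_mono) auto
    moreover have "closed (C r n)" "convex (C r n)" "C r n \<noteq> {}" for n
      unfolding C_def by (auto intro: convex_closure)
    ultimately obtain w where "\<forall>n. w \<in> C r n"
      using nested_closed_convex_Inter_nonempty[of "C r"] by blast
    then show ?thesis using cluster[OF r, of w] unfolding C_def by blast
  qed
  \<comment> \<open>If a linear functional converges along the whole sequence, a common point is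
    squeezed between half-spaces and takes the limit value.\<close>
  have const: "inner y w = l"
    if "\<And>n. w \<in> C r n" and r: "strict_mono r" and l: "(\<lambda>k. inner y (x k)) \<longlonglongrightarrow> l" for r w y l
  proof -
    have lr: "(\<lambda>k. inner y (x (r k))) \<longlonglongrightarrow> l"
      using LIMSEQ_subseq_LIMSEQ[OF l r] by (simp add: o_def)
    have "\<bar>inner y w - l\<bar> \<le> e" if e: "e > 0" for e
    proof -
      obtain n where n: "\<And>k. k \<ge> n \<Longrightarrow> \<bar>inner y (x (r k)) - l\<bar> < e"
        using LIMSEQ_D[OF lr e] by (metis real_norm_def)
      have "inner y (x (r k)) \<le> l + e" "inner (- y) (x (r k)) \<le> - l + e" if "k \<ge> n" for k
        using n[OF that] by auto
      then have "w \<in> {w. inner y w \<le> l + e}" "w \<in> {w. inner (- y) w \<le> - l + e}"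
        using half[of n y r "l + e"] half[of n "- y" r "- l + e"] \<open>w \<in> C r n\<close> by blast+
      then show ?thesis by auto
    qed
    then show ?thesis
      by (metis abs_le_zero_iff eq_iff_diff_eq_0 field_le_epsilon add_0)
  qed
  obtain z where z: "z \<in> S" "\<And>n. z \<in> C id n" using point[of id] by (auto simp: strict_mono_id)
  \<comment> \<open>Expanding the two squared distances shows that
    \<open>inner (w - z) (x k)\<close> converges. Both points take the limit value, so
    \<open>w - z\<close> is orthogonal to itself.\<close>
  have unique: "w = z" if w: "w \<in> S" "\<And>n. w \<in> C r n" and r: "strict_mono r" for w r
  proof -
    obtain p q where p: "(\<lambda>k. norm (x k - w)) \<longlonglongrightarrow> p" and q: "(\<lambda>k. norm (x k - z)) \<longlonglongrightarrow> q"
      using fejer w(1) z(1) unfolding convergent_def by blast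
    have "inner (w - z) (x k) = ((norm (x k - z))\<^sup>2 - (norm (x k - w))\<^sup>2
        + (norm w)\<^sup>2 - (norm z)\<^sup>2) / 2" for k
      unfolding power2_norm_eq_inner
      by (simp add: inner_diff_left inner_diff_right inner_commute)
    moreover have "(\<lambda>k. ((norm (x k - z))\<^sup>2 - (norm (x k - w))\<^sup>2
        + (norm w)\<^sup>2 - (norm z)\<^sup>2) / 2) \<longlonglongrightarrow> (q\<^sup>2 - p\<^sup>2 + (norm w)\<^sup>2 - (norm z)\<^sup>2) / 2"
      by (intro tendsto_intros p q) simp
    ultimately have l: "(\<lambda>k. inner (w - z) (x k)) \<longlonglongrightarrow> (q\<^sup>2 - p\<^sup>2 + (norm w)\<^sup>2 - (norm z)\<^sup>2) / 2"
      by presburger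
    have "inner (w - z) w = inner (w - z) z"
      using const[OF w(2) r l] const[OF z(2) strict_mono_id l] by simp
    then have "inner (w - z) (w - z) = 0" by (simp add: inner_diff_right)
    then show ?thesis by simp
  qed
  \<comment> \<open>Infinitely many violations would form a subsequence with a common point in the
    opposite half-space, although uniqueness identifies that point with \<open>z\<close>. Applied to
    \<open>y\<close> and \<open>- y\<close>, this gives both sides of weak convergence.\<close>
  have limsup: "eventually (\<lambda>k. inner y (x k) < inner y z + e) sequentially" if e: "e > 0" for y e
  proof (rule ccontr)
    assume "\<not> ?thesis"
    then have "infinite {k. inner y z + e \<le> inner y (x k)}"
      by (metis (mono_tags, lifting) cofinite_eq_sequentially eventually_cofinite not_le
          Collect_cong)
    then obtain r :: "nat \<Rightarrow> nat" where r: "strict_mono r" "\<And>k. inner y z + e \<le> inner y (x (r k))"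
      using infinite_enumerate by (metis (mono_tags, lifting) mem_Collect_eq)
    obtain w where w: "w \<in> S" "\<And>n. w \<in> C r n" using point[OF r(1)] by blast
    have "w \<in> {w. inner (- y) w \<le> - (inner y z + e)}"
      using half[of 0 "- y" r "- (inner y z + e)"] r(2) w(2)[of 0] by (auto simp del: minus_add_distrib)
    then show False using unique[OF w r(1)] e by simp
  qed
  have "(\<lambda>k. inner (x k) y) \<longlonglongrightarrow> inner z y" for y
  proof (rule LIMSEQ_I)
    fix e :: real assume e: "e > 0"
    have "eventually (\<lambda>k. norm (inner (x k) y - inner z y) < e) sequentially"
      using limsup[OF e, of y] limsup[OF e, of "- y"]
      by eventually_elim (auto simp: inner_commute)
    then show "\<exists>n. \<forall>k\<ge>n. norm (inner (x k) y - inner z y) < e"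
      by (simp add: eventually_sequentially)
  qed
  then show ?thesis using z(1) unfolding weakly_converges_to_def by blast
qed

text \<open>Monotonicity between a fixed graph point \<open>(y, v)\<close> and the almost-zeros near
  \<open>x k\<close> gives \<open>inner v (x k) \<le> inner v y + e\<close> for late
  \<open>k\<close>. Half-spaces pass to the tail hulls, so \<open>(w, 0)\<close> is monotonically
  related to the graph and maximality applies.\<close>

lemma weakly_converges_if_asymptotic_zeros:
  fixes T :: "'a::{real_inner, complete_space} \<Rightarrow> 'a set"
  assumes T: "max_monotone_op T" and ne: "zer T \<noteq> {}"
    and fejer: "\<And>z k. z \<in> zer T \<Longrightarrow> norm (x (Suc k) - z) \<le> norm (x k - z)"
    and approx: "\<And>\<rho>. \<rho> > 0 \<Longrightarrow>
       eventually (\<lambda>k. \<exists>y. \<exists>v\<in>T y. norm v \<le> \<rho> \<and> norm (x k - y) \<le> \<rho>) sequentially"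
  shows "\<exists>z\<in>zer T. weakly_converges_to x z"
proof (rule weakly_converges_by_tail_hulls[OF ne])
  fix z assume z: "z \<in> zer T"
  have dec: "decseq (\<lambda>k. norm (x k - z))" using fejer[OF z] by (simp add: decseq_Suc_iff)
  show "convergent (\<lambda>k. norm (x k - z))"
    using decseq_convergent[OF dec, of 0] unfolding convergent_def by (metis norm_ge_zero)
next
  obtain z0 where z0: "z0 \<in> zer T" using ne by blast
  define M where "M = norm (x 0 - z0) + norm z0"
  have M: "norm (x k) \<le> M" for k
  proof -
    have "norm (x k - z0) \<le> norm (x 0 - z0)"
      by (induction k) (use fejer[OF z0] order_trans in \<open>blast+\<close>)
    then show ?thesis unfolding M_def using norm_triangle_sub[of "x k" z0] by linarith
  qed
  fix r :: "nat \<Rightarrow> nat" and w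
  assume r: "strict_mono r" and w: "\<And>n. w \<in> closure (convex hull ((\<lambda>k. x (r k)) ` {n..}))"
  have "0 \<le> inner (0 - v) (w - y)" if v: "v \<in> T y" for y v
  proof -
    have "inner v w \<le> inner v y + e" if e: "e > 0" for e
    proof -
      \<comment> \<open>\<open>K\<close> collects the factors of \<open>\<rho>\<close>:
        \<open>norm y + M + 1\<close> bounds the distance from \<open>y\<close> to \<open>y'\<close>
        once \<open>\<rho> \<le> 1\<close>, and \<open>norm v\<close> pays for replacing
        \<open>x k\<close> by \<open>y'\<close>.\<close>
      define K where "K = norm y + M + 1 + norm v"
      have M0: "M \<ge> 0" unfolding M_def by simp
      then have K: "K > 0" unfolding K_def by (smt (verit) norm_ge_zero)
      define \<rho> where "\<rho> = min 1 (e / K)"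
      have \<rho>: "\<rho> > 0" "\<rho> \<le> 1" "\<rho> * K \<le> e"
        unfolding \<rho>_def using e K by (auto simp: min_def field_simps)
      obtain N where N: "\<And>k. k \<ge> N \<Longrightarrow> \<exists>y. \<exists>v\<in>T y. norm v \<le> \<rho> \<and> norm (x k - y) \<le> \<rho>"
        using approx[OF \<rho>(1)] unfolding eventually_sequentially by blast
      have "inner v (x k) \<le> inner v y + e" if k: "k \<ge> N" for k
      proof -
        obtain y' v' where *: "v' \<in> T y'" "norm v' \<le> \<rho>" "norm (x k - y') \<le> \<rho>"
          using N[OF k] by blast
        have "0 \<le> inner (v - v') (y - y')"
          using T v *(1) unfolding max_monotone_op_def monotone_op_def by blast
        then have "inner v y' \<le> inner v y - inner v' (y - y')"
          by (simp add: inner_diff_left inner_diff_right)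
        moreover have "- inner v' (y - y') \<le> \<rho> * (norm y + M + 1)"
        proof -
          have "norm y' \<le> M + 1"
            using M[of k] *(3) \<rho>(2) norm_triangle_sub[of y' "x k"] by (simp add: norm_minus_commute)
          then have "norm (y - y') \<le> norm y + M + 1" using norm_triangle_ineq4[of y y'] by linarith
          then have "norm v' * norm (y - y') \<le> \<rho> * (norm y + M + 1)"
            using *(2) \<rho>(1) by (intro mult_mono) auto
          then show ?thesis using norm_cauchy_schwarz[of "- v'" "y - y'"] by simp
        qed
        ultimately have 1: "inner v y' \<le> inner v y + \<rho> * (norm y + M + 1)" by simp
        have "inner v (x k) - inner v y' \<le> norm v * norm (x k - y')"
          using norm_cauchy_schwarz[of v "x k - y'"] by (simp add: inner_diff_right)
        also have "\<dots> \<le> norm v * \<rho>"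
          using *(3) by (intro mult_left_mono) auto
        finally show ?thesis using 1 \<rho>(3) unfolding K_def by (simp add: algebra_simps)
      qed
      moreover have "k \<le> r k" for k using r by (simp add: seq_suble)
      ultimately have "closure (convex hull ((\<lambda>k. x (r k)) ` {N..})) \<subseteq> {w. inner v w \<le> inner v y + e}"
        by (intro closure_minimal hull_minimal closed_halfspace_le convex_halfspace_le)
          (auto intro: order_trans)
      then show ?thesis using w[of N] by blast
    qed
    then have "inner v w \<le> inner v y" by (rule field_le_epsilon)
    then show ?thesis by (simp add: inner_diff_right)
  qed
  then show "w \<in> zer T" using T unfolding max_monotone_op_def zer_def by blast
qed

section \<open>The projection step\<close>

text \<open>Monotonicity between the two graph points bounds the squared norm of \<open>v\<close> by
  \<open>inner u v\<close>. The comparison trajectory is built from such steps.\<close>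

lemma resolvent_step:
  fixes T :: "'a::{real_inner, complete_space} \<Rightarrow> 'a set"
  assumes T: "max_monotone_op T" and l: "l > 0" and u: "u \<in> T y"
  obtains v where "v \<in> T (y - l *\<^sub>R v)" "norm v \<le> norm u"
proof -
  obtain y' v where v: "v \<in> T y'" "y = y' + l *\<^sub>R v" using resolvent_exists[OF T l] by blast
  have "0 \<le> inner (u - v) (y - y')"
    using T u v(1) unfolding max_monotone_op_def monotone_op_def by blast
  then have "(norm v)\<^sup>2 \<le> inner u v"
    using l v(2) by (simp add: inner_diff_left power2_norm_eq_inner zero_le_mult_iff)
  also have "\<dots> \<le> norm u * norm v" by (rule norm_cauchy_schwarz)
  finally have "norm v \<le> norm u"
    by (cases "v = 0") (simp_all add: power2_eq_square)
  moreover have "y' = y - l *\<^sub>R v" using v(2) by simp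
  ultimately show thesis using that v(1) by blast
qed

text \<open>The candidate \<open>p\<close> lies on the bounding hyperplane and \<open>x - p\<close>
  is a nonnegative multiple of \<open>n\<close>, which gives the Pythagorean inequality
  \<open>pyth\<close>. It yields minimality and also the uniqueness demanded by the definite
  description in \<open>proj\<close>.\<close>

lemma proj_halfspace:
  fixes n x c :: "'a::real_inner"
  assumes n: "n \<noteq> 0" and out: "r \<le> inner n (x - c)"
  shows "proj {y. inner n (y - c) \<le> r} x = x - ((inner n (x - c) - r) / (norm n)\<^sup>2) *\<^sub>R n"
proof -
  define l where "l = (inner n (x - c) - r) / (norm n)\<^sup>2"
  define p where "p = x - l *\<^sub>R n"
  have l: "l \<ge> 0" "l * inner n n = inner n (x - c) - r"
    unfolding l_def using n out by (auto simp: power2_norm_eq_inner)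
  have pc: "inner n (p - c) = r"
  proof -
    have "p - c = (x - c) - l *\<^sub>R n" unfolding p_def by simp
    then show ?thesis using l(2) by (simp add: inner_diff_right)
  qed
  have pyth: "(norm (x - p))\<^sup>2 + (norm (p - y))\<^sup>2 \<le> (norm (x - y))\<^sup>2" if "inner n (y - c) \<le> r" for y
  proof -
    have "inner n (p - y) = inner n (p - c) - inner n (y - c)" by (simp add: inner_diff_right)
    then have "0 \<le> l * inner n (p - y)" using that pc l(1) by simp
    also have "\<dots> = inner (x - p) (p - y)" by (simp add: p_def)
    finally show ?thesis using dot_norm[of "x - p" "p - y"] by simp
  qed
  have "proj {y. inner n (y - c) \<le> r} x = p"
    unfolding proj_def
  proof (rule the_equality)
    have "norm (x - p) \<le> norm (x - y)" if "inner n (y - c) \<le> r" for y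
      using pyth[OF that] by (smt (verit) norm_ge_zero power2_le_imp_le zero_le_power2)
    then show "p \<in> {y. inner n (y - c) \<le> r}
        \<and> (\<forall>y\<in>{y. inner n (y - c) \<le> r}. norm (x - p) \<le> norm (x - y))"
      using pc by simp
  next
    fix q assume q: "q \<in> {y. inner n (y - c) \<le> r}
        \<and> (\<forall>y\<in>{y. inner n (y - c) \<le> r}. norm (x - q) \<le> norm (x - y))"
    then have "norm (x - q) \<le> norm (x - p)" using pc by simp
    then have "(norm (x - q))\<^sup>2 \<le> (norm (x - p))\<^sup>2" by (simp add: power_mono)
    moreover have "(norm (x - p))\<^sup>2 + (norm (p - q))\<^sup>2 \<le> (norm (x - q))\<^sup>2" using pyth q by simp
    ultimately have "(norm (p - q))\<^sup>2 \<le> 0" by linarith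
    then show "q = p" by simp
  qed
  then show ?thesis unfolding p_def l_def .
qed

lemma proj_UNIV: "proj UNIV x = x"
  unfolding proj_def by (rule the_equality) (auto dest: spec[of _ x])

locale cocoercive_splitting =
  fixes A1 A2 :: "'a::{real_inner, complete_space} \<Rightarrow> 'a"
    and B :: "'a \<Rightarrow> 'a set" and \<beta> :: real
  assumes beta_pos: "\<beta> > 0"
    and A1_coco: "cocoercive \<beta> A1"
    and A2_mm: "max_monotone_op (\<lambda>z. {A2 z})"
    and A2_uc: "uniformly_continuous_on UNIV A2"
    and B_mm: "max_monotone_op B"
begin

abbreviation A :: "'a \<Rightarrow> 'a" where "A \<equiv> (\<lambda>z. A1 z + A2 z)"

abbreviation AB :: "'a \<Rightarrow> 'a set" where "AB \<equiv> (\<lambda>z. {A1 z + A2 z} + B z)"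

abbreviation fb :: "real \<Rightarrow> 'a \<Rightarrow> 'a" where "fb \<equiv> trial_point A B"

abbreviation normal :: "real \<Rightarrow> 'a \<Rightarrow> 'a" where
  "normal a x \<equiv> (1 / a) *\<^sub>R (x - fb a x) - (A2 x - A2 (fb a x))"

lemma A1_coco': "inner (A1 x - A1 y) (x - y) \<ge> \<beta> * (norm (A1 x - A1 y))\<^sup>2"
  using A1_coco unfolding cocoercive_def by blast

lemma A2_mono: "inner (A2 x - A2 y) (x - y) \<ge> 0"
  using A2_mm unfolding max_monotone_op_def monotone_op_def by blast

lemma B_mono: "u \<in> B x \<Longrightarrow> v \<in> B y \<Longrightarrow> inner (u - v) (x - y) \<ge> 0"
  using B_mm unfolding max_monotone_op_def monotone_op_def by blast

lemma A1_uc: "uniformly_continuous_on UNIV A1"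
  unfolding uniformly_continuous_on_def
proof (intro allI impI)
  fix e :: real assume e: "e > 0"
  have "norm (A1 x - A1 y) < e" if "norm (x - y) < \<beta> * e" for x y
  proof -
    have "\<beta> * (norm (A1 x - A1 y))\<^sup>2 \<le> norm (A1 x - A1 y) * norm (x - y)"
      using A1_coco'[of x y] norm_cauchy_schwarz order_trans by blast
    then have "\<beta> * norm (A1 x - A1 y) \<le> norm (x - y)"
      by (cases "A1 x = A1 y") (simp_all add: power2_eq_square)
    then have "\<beta> * norm (A1 x - A1 y) < \<beta> * e" using that by simp
    then show ?thesis using beta_pos by simp
  qed
  then show "\<exists>d>0. \<forall>x\<in>UNIV. \<forall>x'\<in>UNIV. dist x' x < d \<longrightarrow> dist (A1 x') (A1 x) < e"
    using e beta_pos by (intro exI[of _ "\<beta> * e"]) (auto simp: dist_norm)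
qed

lemma A_uc: "uniformly_continuous_on UNIV A"
  by (intro uniformly_continuous_on_add A1_uc A2_uc)

lemma A_mono: "inner (A x - A y) (x - y) \<ge> 0"
proof -
  have "0 \<le> \<beta> * (norm (A1 x - A1 y))\<^sup>2" using beta_pos by simp
  then have "0 \<le> inner (A1 x - A1 y) (x - y) + inner (A2 x - A2 y) (x - y)"
    using A1_coco'[of x y] A2_mono[of x y] by linarith
  then show ?thesis by (simp add: inner_diff_left inner_add_left)
qed

lemma AB_mm: "max_monotone_op AB"
  by (rule max_monotone_op_add_uniformly_continuous[OF A_mono A_uc B_mm])

lemma fb_in: "a > 0 \<Longrightarrow> (1 / a) *\<^sub>R (x - fb a x) - A x \<in> B (fb a x)"
  using resolvent_in[OF B_mm, of a "x - a *\<^sub>R A x"]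
  unfolding trial_point_def by (simp add: scaleR_diff_right algebra_simps)

lemma fb_residual: "a > 0 \<Longrightarrow> (1 / a) *\<^sub>R (x - fb a x) - A x + A (fb a x) \<in> AB (fb a x)"
  using set_plus_intro[OF singletonI fb_in, of a "A (fb a x)" x] by (simp add: algebra_simps)

lemma fb_fixed:
  assumes "a > 0" and "- A x \<in> B x" shows "fb a x = x"
  unfolding trial_point_def
  by (rule resolvent_eq[where u = "- A x"]) (use assms B_mm in \<open>auto simp: max_monotone_op_def scaleR_add_right scaleR_diff_right\<close>)

text \<open>Monotonicity of \<open>B\<close> makes the product of \<open>norm p - norm q\<close> and
  \<open>norm p / a - norm q / a'\<close> nonpositive, whereas both factors would be positive. This
  serves to pass from the last rejected trial step to the smaller accepted one.\<close>

lemma norm_fb_step_mono: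
  assumes "0 < a" "a \<le> a'"
  shows "norm (x - fb a x) \<le> norm (x - fb a' x)"
proof (rule ccontr)
  define p q where "p = x - fb a x" and "q = x - fb a' x"
  assume "\<not> ?thesis"
  then have lt: "norm q < norm p" by (simp add: p_def q_def)
  have "0 \<le> inner ((1/a) *\<^sub>R p - (1/a') *\<^sub>R q) (q - p)"
    using B_mono[OF fb_in[of a x] fb_in[of a' x]] assms by (simp add: p_def q_def)
  then have "inner p p / a + inner q q / a' \<le> (1/a + 1/a') * inner p q"
    by (simp add: inner_diff_left inner_diff_right inner_commute distrib_right diff_divide_distrib)
  also have "\<dots> \<le> (1/a + 1/a') * (norm p * norm q)"
    using assms norm_cauchy_schwarz[of p q] by (intro mult_left_mono) auto
  finally have "(norm p - norm q) * (norm p / a - norm q / a') \<le> 0"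
    by (simp add: power2_norm_eq_inner[symmetric] power2_eq_square algebra_simps)
  moreover have "norm q / a' < norm p / a"
  proof -
    have "norm q / a' \<le> norm q / a" using assms by (intro divide_left_mono) auto
    also have "\<dots> < norm p / a" using lt assms by (simp add: divide_strict_right_mono)
    finally show ?thesis .
  qed
  ultimately show False using lt by (simp add: mult_le_0_iff)
qed

text \<open>Permanent failure would force \<open>y j\<close> to \<open>x\<close> and
  \<open>(x - y j) / t j\<close> to 0, by the same two-stage limit as for maximality of the sum. The
  closed graph of \<open>B\<close> then makes \<open>x\<close> a zero of \<open>A + B\<close>, hence
  a fixed point of every trial, where the test holds as \<open>0 \<le> 0\<close>.\<close>

lemma line_search_terminates:
  assumes theta: "0 < \<theta>" "\<theta> < 1" and d: "0 < \<delta>" and a: "0 < a"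
  shows "\<exists>j. a * \<theta> ^ j * inner (A2 x - A2 (fb (a * \<theta> ^ j) x)) (x - fb (a * \<theta> ^ j) x)
    \<le> \<delta> * (norm (x - fb (a * \<theta> ^ j) x))\<^sup>2"
proof (rule ccontr)
  define t where "t j = a * \<theta> ^ j" for j :: nat
  define y where "y j = fb (t j) x" for j
  assume "\<not> ?thesis"
  then have fail: "\<delta> * (norm (x - y j))\<^sup>2 < t j * inner (A2 x - A2 (y j)) (x - y j)" for j
    unfolding t_def y_def by (auto simp: not_le)
  have t: "t j > 0" for j unfolding t_def using a theta by simp
  have "t \<longlonglongrightarrow> a * 0"
    unfolding t_def by (intro tendsto_intros LIMSEQ_power_zero) (use theta in auto)
  then have t0: "(\<lambda>j. t j / \<delta>) \<longlonglongrightarrow> 0" by (auto intro: tendsto_divide_zero)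
  obtain L where L: "L \<ge> 0" "\<And>x y. norm (A2 x - A2 y) \<le> 1 + L * norm (x - y)"
    using uniformly_continuous_linear_growth[OF A2_uc] by metis
  have le: "norm (x - y j) \<le> t j / \<delta> * norm (A2 x - A2 (y j))" for j
  proof (cases "x = y j")
    case False
    have "\<delta> * (norm (x - y j))\<^sup>2 \<le> t j * (norm (A2 x - A2 (y j)) * norm (x - y j))"
      using fail[of j] mult_left_mono[OF norm_cauchy_schwarz[of "A2 x - A2 (y j)" "x - y j"], of "t j"] t[of j]
      by linarith
    then show ?thesis using False d by (simp add: power2_eq_square field_simps)
  qed (use t d less_imp_le in simp)
  have 0: "(\<lambda>j. x - y j) \<longlonglongrightarrow> 0"
  proof (rule norm_tendsto_zero_if_le_growth[OF _ t0 _ L(1)])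
    fix j show "norm (x - y j) \<le> t j / \<delta> * (1 + L * norm (x - y j))"
      using le[of j] mult_left_mono[OF L(2)[of x "y j"], of "t j / \<delta>"] t[of j] d
      by (meson divide_nonneg_pos less_imp_le order_trans)
  next
    fix j show "0 \<le> t j / \<delta>" using t[of j] d by simp
  qed
  have "(\<lambda>j. A2 x - A2 (y j)) \<longlonglongrightarrow> 0"
    by (rule uniformly_continuous_diff_tendsto_zero[OF A2_uc 0])
  then have "(\<lambda>j. (1/\<delta>) *\<^sub>R (A2 x - A2 (y j))) \<longlonglongrightarrow> (1/\<delta>) *\<^sub>R 0" by (intro tendsto_intros)
  then have "(\<lambda>j. (1/\<delta>) *\<^sub>R (A2 x - A2 (y j))) \<longlonglongrightarrow> 0" by simp
  then have "(\<lambda>j. (1 / t j) *\<^sub>R (x - y j)) \<longlonglongrightarrow> 0"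
  proof (rule Lim_null_comparison[OF _ tendsto_norm_zero, rotated])
    have "norm (x - y j) / t j \<le> norm (A2 x - A2 (y j)) / \<delta>" for j
      using le[of j] t[of j] by (simp add: pos_divide_le_eq mult.commute)
    then show "\<forall>\<^sub>F j in sequentially. norm ((1 / t j) *\<^sub>R (x - y j)) \<le> norm ((1/\<delta>) *\<^sub>R (A2 x - A2 (y j)))"
      using t d by (auto intro!: always_eventually simp: less_imp_le)
  qed
  then have u: "(\<lambda>j. (1 / t j) *\<^sub>R (x - y j) - A x) \<longlonglongrightarrow> 0 - A x" by (intro tendsto_intros)
  have yx: "y \<longlonglongrightarrow> x" using tendsto_diff[OF tendsto_const[of x] 0] by simp
  have "- A x \<in> B x"
    using max_monotone_op_graph_closed[OF B_mm _ yx u] fb_in[OF t] unfolding y_def by simp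
  then have "y 0 = x" unfolding y_def by (rule fb_fixed[OF t])
  then show False using fail[of 0] by simp
qed

text \<open>For \<open>v = 0\<close> this says that the half-space of the method contains the zeros of \<open>A + B\<close>.\<close>
lemma normal_cut:
  assumes a: "a > 0" and v: "v \<in> AB y"
  shows "inner (normal a x - v) (fb a x - y) \<ge> - ((norm (x - fb a x))\<^sup>2 / (4 * \<beta>))"
proof -
  define b where "b = fb a x"
  define g where "g = (1/a) *\<^sub>R (x - b)"
  obtain u where u: "u \<in> B y" "v = A y + u" using v by (auto elim!: set_plus_elim)
  have 1: "0 \<le> inner (g - A x - u) (b - y)"
    using B_mono[OF fb_in[OF a, of x] u(1)] unfolding g_def b_def .
  \<comment> \<open>Cocoercivity pairs the increment \<open>d\<close> with \<open>x - y\<close>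
    rather than \<open>b - y\<close>. The difference, a product with \<open>x - b\<close>, is
    absorbed by completing the square.\<close>
  have 2: "inner (A1 x - A1 y) (b - y) \<ge> - ((norm (x - b))\<^sup>2 / (4 * \<beta>))"
  proof -
    define d where "d = A1 x - A1 y"
    have "inner d (b - y) = inner d (x - y) - inner d (x - b)" by (simp add: inner_diff_right)
    moreover have "inner d (x - y) \<ge> \<beta> * (norm d)\<^sup>2" unfolding d_def by (rule A1_coco')
    moreover have "inner d (x - b) \<le> norm d * norm (x - b)" by (rule norm_cauchy_schwarz)
    moreover have "norm d * norm (x - b) \<le> \<beta> * (norm d)\<^sup>2 + (norm (x - b))\<^sup>2 / (4 * \<beta>)"
    proof -
      have "0 \<le> (2 * \<beta> * norm d - norm (x - b))\<^sup>2 / (4 * \<beta>)" using beta_pos by simp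
      also have "\<dots> = \<beta> * (norm d)\<^sup>2 + (norm (x - b))\<^sup>2 / (4 * \<beta>) - norm d * norm (x - b)"
        using beta_pos by (simp add: power2_eq_square field_simps)
      finally show ?thesis by simp
    qed
    ultimately show ?thesis unfolding d_def by linarith
  qed
  have "g - (A2 x - A2 b) - v = (g - A x - u) + (A1 x - A1 y) + (A2 b - A2 y)"
    unfolding u(2) by (simp add: algebra_simps)
  from arg_cong[OF this, of "\<lambda>w. inner w (b - y)"] have "inner (g - (A2 x - A2 b) - v) (b - y)
      = inner (g - A x - u) (b - y) + inner (A1 x - A1 y) (b - y) + inner (A2 b - A2 y) (b - y)"
    by (simp only: inner_add_left)
  then show ?thesis using 1 2 A2_mono[of b y] unfolding g_def b_def by linarith
qed

text \<open>One step of the method decreases the squared distance not only to the zeros of \<open>A + B\<close>, but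
  up to a controlled error also to a point \<open>y\<close> that itself moves by a proximal step of \<open>A + B\<close>
  with the same step length \<open>l\<close>.\<close>
lemma projection_step:
  assumes a: "0 < a" "a \<le> 4 * \<beta> * \<delta>bar" and kap: "1 - \<delta> - \<delta>bar > 0" and db: "\<delta>bar > 0"
    and ls: "a * inner (A2 x - A2 (fb a x)) (x - fb a x) \<le> \<delta> * (norm (x - fb a x))\<^sup>2"
    and moved: "proj (halfspace_T A A2 B \<delta>bar a x) x \<noteq> x"
  obtains l where "l > 0"
    "proj (halfspace_T A A2 B \<delta>bar a x) x = x - l *\<^sub>R normal a x"
    "l * (norm (normal a x))\<^sup>2 \<le> (norm (x - fb a x))\<^sup>2 / a"
    "(1 - \<delta> - \<delta>bar) * ((norm (x - fb a x))\<^sup>2 / a) \<le> l * (norm (normal a x))\<^sup>2"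
    "\<And>y v. v \<in> AB (y - l *\<^sub>R v) \<Longrightarrow>
       (norm (proj (halfspace_T A A2 B \<delta>bar a x) x - (y - l *\<^sub>R v)))\<^sup>2
       \<le> (norm (x - y))\<^sup>2 - (1 - \<delta> - \<delta>bar) * (l * (norm (x - fb a x))\<^sup>2 / a)
          + 2 * l * inner v (x - fb a x)"
proof -
  define b where "b = fb a x"
  define n where "n = normal a x"
  define D where "D = (norm (x - b))\<^sup>2"
  define r where "r = \<delta>bar / a * D"
  define l where "l = (inner n (x - b) - r) / (norm n)\<^sup>2"
  define \<kappa> where "\<kappa> = 1 - \<delta> - \<delta>bar"
  have T: "halfspace_T A A2 B \<delta>bar a x = {y. inner n (y - b) \<le> r}"
    unfolding halfspace_T_def n_def b_def r_def D_def Let_def ..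
  have D: "D > 0"
  proof (rule ccontr)
    assume "\<not> D > 0"
    then have "x = b" unfolding D_def by simp
    then have "halfspace_T A A2 B \<delta>bar a x = UNIV"
      unfolding T r_def D_def n_def b_def[symmetric] by simp
    then show False using moved proj_UNIV by metis
  qed
  have nxb: "inner n (x - b) = D / a - inner (A2 x - A2 b) (x - b)"
    unfolding n_def b_def[symmetric] D_def by (simp add: inner_diff_left power2_norm_eq_inner)
  have "inner (A2 x - A2 b) (x - b) \<le> \<delta> * D / a"
    using ls a unfolding b_def[symmetric] D_def by (simp add: pos_le_divide_eq mult.commute)
  then have low: "\<kappa> * (D / a) \<le> inner n (x - b) - r"
    unfolding nxb r_def \<kappa>_def by (simp add: left_diff_distrib diff_divide_distrib)
  have pos: "\<kappa> * (D / a) > 0" using D a kap unfolding \<kappa>_def by simp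
  have r0: "r > 0" unfolding r_def using D a db by simp
  have n0: "n \<noteq> 0" using low pos r0 by auto
  have ln: "l * (norm n)\<^sup>2 = inner n (x - b) - r" unfolding l_def using n0 by simp
  have l0: "l > 0" unfolding l_def using low pos n0 by simp
  have step: "proj (halfspace_T A A2 B \<delta>bar a x) x = x - l *\<^sub>R n"
    unfolding T l_def by (rule proj_halfspace[OF n0]) (use low pos in linarith)
  have up: "l * (norm n)\<^sup>2 \<le> D / a"
    unfolding ln nxb using A2_mono[of x b] r0 by linarith
  have "(norm (x - l *\<^sub>R n - (y - l *\<^sub>R v)))\<^sup>2
      \<le> (norm (x - y))\<^sup>2 - \<kappa> * (l * D / a) + 2 * l * inner v (x - b)"
    if v: "v \<in> AB (y - l *\<^sub>R v)" for y v
  proof -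
    define y' where "y' = y - l *\<^sub>R v"
    have cut: "- r \<le> inner (n - v) (b - y')"
    proof -
      \<comment> \<open>Here the bound \<open>a \<le> 4 * \<beta> * \<delta>bar\<close> enters: the
        cocoercivity error fits into \<open>r\<close>.\<close>
      have "D / (4 * \<beta>) \<le> r"
        unfolding r_def using a(2) a(1) beta_pos D by (simp add: field_simps)
      then show ?thesis
        using normal_cut[OF a(1) v, of x] unfolding n_def b_def y'_def D_def by linarith
    qed
    have "x - y = (b - y') + (x - b) - l *\<^sub>R v" unfolding y'_def by simp
    then have e: "inner (n - v) (x - y) = inner (n - v) (b - y') + inner (n - v) (x - b) - l * inner (n - v) v"
      by (metis inner_add_right inner_diff_right inner_scaleR_right)
    have "x - l *\<^sub>R n - (y - l *\<^sub>R v) = (x - y) - l *\<^sub>R (n - v)" by (simp add: algebra_simps)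
    then have "(norm (x - l *\<^sub>R n - (y - l *\<^sub>R v)))\<^sup>2
        = (norm (x - y))\<^sup>2 - 2 * l * inner (n - v) (x - y) + l * (l * inner (n - v) (n - v))"
      unfolding power2_norm_eq_inner by (simp add: inner_diff_left inner_diff_right inner_commute algebra_simps)
    also have "\<dots> = (norm (x - y))\<^sup>2 + l * (- 2 * inner (n - v) (b - y') - 2 * inner n (x - b)
        + 2 * inner v (x - b) + l * inner n n - l * inner v v)"
      unfolding e by (simp add: inner_diff_left inner_diff_right inner_commute algebra_simps)
    \<comment> \<open>The cut contributes at most \<open>2 * r\<close>, and \<open>ln\<close>
      replaces \<open>l * inner n n\<close> by \<open>inner n (x - b) - r\<close>. What remains is
      the negative of that same difference, estimated by \<open>low\<close>.\<close>
    also have "\<dots> \<le> (norm (x - y))\<^sup>2 + l * (- \<kappa> * (D / a) + 2 * inner v (x - b))"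
    proof -
      have "0 \<le> l * inner v v" using l0 by simp
      then show ?thesis
        using cut low ln l0 unfolding power2_norm_eq_inner
        by (intro add_left_mono mult_left_mono) linarith+
    qed
    finally show ?thesis by (simp add: algebra_simps)
  qed
  then show thesis
    using that[of l] l0 step up low ln unfolding \<kappa>_def D_def n_def b_def by simp
qed

end

section \<open>Weak convergence of the method\<close>

theorem theorem4p9:
  fixes A1 A2 :: "'a::{real_inner, complete_space} \<Rightarrow> 'a"
    and B :: "'a \<Rightarrow> 'a set"
    and \<beta> \<theta> \<delta> \<delta>bar :: real
    and x :: "nat \<Rightarrow> 'a"
    and \<alpha> :: "nat \<Rightarrow> real"
  assumes beta_pos: "\<beta> > 0"
    and A1_coco: "cocoercive \<beta> A1"
    and A2_mm: "max_monotone_op (\<lambda>z. {A2 z})"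
    and A2_uc: "uniformly_continuous_on UNIV A2"
    and B_mm: "max_monotone_op B"
    and zer_ne: "zer (\<lambda>z. {A1 z + A2 z} + B z) \<noteq> {}"
    and theta: "0 < \<theta>" "\<theta> < 1"
    and delta: "0 < \<delta>" "\<delta> < 1"
    and deltabar: "\<delta>bar > 0" "1 - \<delta> - \<delta>bar > 0"
    and alpha_init: "\<alpha> 0 > 0" "\<alpha> 0 \<le> 4 * \<beta> * \<delta>bar"
    and alpha_step: "\<And>k. \<alpha> (Suc k) =
          \<alpha> k * \<theta> ^ ls_index (\<lambda>z. A1 z + A2 z) A2 B \<theta> \<delta> (\<alpha> k) (x k)"
    and x_step: "\<And>k. x (Suc k) =
          proj (halfspace_T (\<lambda>z. A1 z + A2 z) A2 B \<delta>bar (\<alpha> (Suc k)) (x k)) (x k)"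
    and no_stop: "\<And>k. x (Suc k) \<noteq> x k"
  shows "\<exists>z \<in> zer (\<lambda>z. {A1 z + A2 z} + B z). weakly_converges_to x z"
proof -
  interpret cocoercive_splitting A1 A2 B \<beta>
    by unfold_locales (fact beta_pos A1_coco A2_mm A2_uc B_mm)+

  \<comment> \<open>Step sizes and the line search\<close>
  define \<kappa> where "\<kappa> = 1 - \<delta> - \<delta>bar"
  have \<kappa>: "\<kappa> > 0" using deltabar unfolding \<kappa>_def by simp
  \<comment> \<open>Index shift: \<open>\<alpha> 0\<close> is the prescribed initial step, and
    iteration \<open>k\<close> works with \<open>\<alpha> (Suc k)\<close>.\<close>
  define a where "a k = \<alpha> (Suc k)" for k
  define b where "b k = fb (a k) (x k)" for k
  define D where "D k = norm (x k - b k)" for k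
  define n where "n k = normal (a k) (x k)" for k
  have alpha_pos: "\<alpha> k > 0" for k
    by (induction k) (use alpha_init theta in \<open>auto simp: alpha_step\<close>)
  have alpha_dec: "\<alpha> (Suc k) \<le> \<alpha> k" for k
    unfolding alpha_step using alpha_pos[of k] theta
    by (simp add: mult_left_le power_le_one less_imp_le)
  have alpha_le: "\<alpha> k \<le> \<alpha> 0" for k
    by (induction k) (use alpha_dec order_trans in \<open>blast+\<close>)
  have a: "0 < a k" "a k \<le> 4 * \<beta> * \<delta>bar" "a k \<le> \<alpha> 0" for k
    unfolding a_def using alpha_pos alpha_le[of "Suc k"] alpha_init by auto
  define accept where "accept k j \<longleftrightarrow>
    \<alpha> k * \<theta> ^ j * inner (A2 (x k) - A2 (fb (\<alpha> k * \<theta> ^ j) (x k))) (x k - fb (\<alpha> k * \<theta> ^ j) (x k))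
    \<le> \<delta> * (norm (x k - fb (\<alpha> k * \<theta> ^ j) (x k)))\<^sup>2" for k j
  have index: "ls_index A A2 B \<theta> \<delta> (\<alpha> k) (x k) = (LEAST j. accept k j)" for k
    unfolding ls_index_def accept_def Let_def ..
  have "\<exists>j. accept k j" for k
    unfolding accept_def by (rule line_search_terminates[OF theta delta(1) alpha_pos])
  then have acc: "accept k (LEAST j. accept k j)" for k by (rule LeastI_ex)
  have ls: "a k * inner (A2 (x k) - A2 (fb (a k) (x k))) (x k - fb (a k) (x k))
      \<le> \<delta> * (norm (x k - fb (a k) (x k)))\<^sup>2" for k
    using acc[of k] unfolding a_def alpha_step index accept_def .

  \<comment> \<open>Descent estimates and summability\<close>
  have "\<exists>l. l > 0 \<and> x (Suc k) = x k - l *\<^sub>R n k \<and>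
    l * (norm (n k))\<^sup>2 \<le> (D k)\<^sup>2 / a k \<and> \<kappa> * ((D k)\<^sup>2 / a k) \<le> l * (norm (n k))\<^sup>2 \<and>
    (\<forall>y v. v \<in> AB (y - l *\<^sub>R v) \<longrightarrow> (norm (x (Suc k) - (y - l *\<^sub>R v)))\<^sup>2
       \<le> (norm (x k - y))\<^sup>2 - \<kappa> * (l * (D k)\<^sup>2 / a k) + 2 * l * inner v (x k - b k))" for k
  proof -
    have step: "x (Suc k) = proj (halfspace_T A A2 B \<delta>bar (a k) (x k)) (x k)"
      unfolding a_def by (rule x_step)
    have moved: "proj (halfspace_T A A2 B \<delta>bar (a k) (x k)) (x k) \<noteq> x k"
      using no_stop[of k] unfolding step .
    show ?thesis
      unfolding step D_def b_def n_def \<kappa>_def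
      by (rule projection_step[OF a(1,2) deltabar(2,1) ls moved], rule exI, intro conjI allI impI)
  qed
  then obtain l where l: "\<And>k. l k > 0" and x_upd: "\<And>k. x (Suc k) = x k - l k *\<^sub>R n k"
    and n_up: "\<And>k. l k * (norm (n k))\<^sup>2 \<le> (D k)\<^sup>2 / a k"
    and n_low: "\<And>k. \<kappa> * ((D k)\<^sup>2 / a k) \<le> l k * (norm (n k))\<^sup>2"
    and descent: "\<And>k y v. v \<in> AB (y - l k *\<^sub>R v) \<Longrightarrow> (norm (x (Suc k) - (y - l k *\<^sub>R v)))\<^sup>2
       \<le> (norm (x k - y))\<^sup>2 - \<kappa> * (l k * (D k)\<^sup>2 / a k) + 2 * l k * inner v (x k - b k)"
    by metis
  define c where "c k = l k * (D k)\<^sup>2 / a k" for k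
  have c0: "c k \<ge> 0" for k unfolding c_def using l[of k] a(1)[of k] by simp
  have zer_descent: "(norm (x (Suc k) - z))\<^sup>2 \<le> (norm (x k - z))\<^sup>2 - \<kappa> * c k" if "z \<in> zer AB" for z k
    using descent[of 0 z k] that unfolding c_def zer_def by simp
  have fejer: "norm (x (Suc k) - z) \<le> norm (x k - z)" if "z \<in> zer AB" for z k
  proof (rule power2_le_imp_le)
    show "(norm (x (Suc k) - z))\<^sup>2 \<le> (norm (x k - z))\<^sup>2"
      using zer_descent[OF that, of k] mult_nonneg_nonneg[OF less_imp_le[OF \<kappa>] c0[of k]] by linarith
  qed simp
  have c_sum: "summable c"
  proof -
    obtain z where z: "z \<in> zer AB" using zer_ne by blast
    have "\<kappa> * (\<Sum>i<m. c i) \<le> (norm (x 0 - z))\<^sup>2 - (norm (x m - z))\<^sup>2" for m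
    proof (induction m)
      case (Suc m)
      then show ?case using zer_descent[OF z, of m] by (simp add: distrib_left)
    qed simp
    then have "(\<Sum>i<m. c i) \<le> (norm (x 0 - z))\<^sup>2 / \<kappa>" for m
      using \<kappa> by (simp add: pos_le_divide_eq mult.commute) (smt (verit) zero_le_power2)
    then show ?thesis using c0 by (intro summableI_nonneg_bounded)
  qed
  then have c_lim: "c \<longlonglongrightarrow> 0" by (rule summable_LIMSEQ_zero)
  have move_lim: "(\<lambda>k. norm (x (Suc k) - x k)) \<longlonglongrightarrow> 0"
  proof -
    have "norm (x (Suc k) - x k) \<le> sqrt (c k)" for k
    proof (rule real_le_rsqrt)
      have "(norm (x (Suc k) - x k))\<^sup>2 = l k * (l k * (norm (n k))\<^sup>2)"
        unfolding x_upd using l[of k] by (simp add: power_mult_distrib power2_eq_square)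
      also have "\<dots> \<le> l k * ((D k)\<^sup>2 / a k)" using n_up l less_imp_le by (intro mult_left_mono) auto
      finally show "(norm (x (Suc k) - x k))\<^sup>2 \<le> c k" by (simp add: c_def)
    qed
    moreover have "(\<lambda>k. sqrt (c k)) \<longlonglongrightarrow> 0" using tendsto_real_sqrt[OF c_lim] by simp
    ultimately show ?thesis
      using Lim_null_comparison[OF always_eventually, of "\<lambda>k. norm (x (Suc k) - x k)" "\<lambda>k. sqrt (c k)"]
      by simp
  qed
  obtain L where L: "L \<ge> 0" "\<And>x y. norm (A2 x - A2 y) \<le> 1 + L * norm (x - y)"
    using uniformly_continuous_linear_growth[OF A2_uc] by metis

  \<comment> \<open>Vanishing forward-backward displacement\<close>
  have D_lim: "D \<longlonglongrightarrow> 0"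
  proof -
    \<comment> \<open>Multiplying \<open>n_low\<close> by \<open>(D k)^2 / a k\<close> gives
      \<open>(D k)^2 / a k \<le> s k * norm (n k)\<close>. Linear growth of \<open>A2\<close> bounds
      \<open>a k * norm (n k)\<close> by \<open>E * D k + \<alpha> 0\<close>. The resulting
      quadratic inequality forces \<open>D\<close> to 0 without a lower bound on the step
      sizes.\<close>
    define s where "s k = sqrt (c k / \<kappa>)" for k
    define E where "E = 1 + \<alpha> 0 * L"
    have s0: "s k \<ge> 0" for k unfolding s_def using c0 \<kappa> by simp
    have s_lim: "s \<longlonglongrightarrow> 0"
      unfolding s_def using tendsto_real_sqrt[OF tendsto_divide_zero[OF c_lim, of \<kappa>]] by simp
    have D0: "D k \<ge> 0" for k unfolding D_def by simp
    have "(D k)\<^sup>2 \<le> (s k)\<^sup>2 * E\<^sup>2 + 2 * s k * \<alpha> 0" for k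
    proof -
      have an: "a k * norm (n k) \<le> E * D k + \<alpha> 0"
      proof -
        have "norm (n k) \<le> D k / a k + (1 + L * D k)"
          unfolding n_def D_def b_def
          using norm_triangle_ineq4[of "(1 / a k) *\<^sub>R (x k - fb (a k) (x k))"] L(2)[of "x k" "fb (a k) (x k)"] a(1)[of k]
          by (smt (verit) abs_of_pos divide_inverse_commute inverse_eq_divide norm_scaleR zero_less_divide_1_iff)
        then have "a k * norm (n k) \<le> a k * (D k / a k + (1 + L * D k))"
          using a(1)[of k] by (intro mult_left_mono) auto
        also have "\<dots> = D k + a k * (1 + L * D k)" using a(1)[of k] by (simp add: distrib_left)
        also have "\<dots> \<le> D k + \<alpha> 0 * (1 + L * D k)"
          using a(3)[of k] L(1) D0[of k] by (intro add_left_mono mult_right_mono) auto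
        finally show ?thesis unfolding E_def by (simp add: algebra_simps)
      qed
      have "(D k)\<^sup>2 / a k \<le> s k * norm (n k)"
      proof (rule power2_le_imp_le)
        have "\<kappa> * ((D k)\<^sup>2 / a k) * ((D k)\<^sup>2 / a k) \<le> l k * (norm (n k))\<^sup>2 * ((D k)\<^sup>2 / a k)"
          using n_low[of k] a(1)[of k] by (intro mult_right_mono) auto
        also have "\<dots> = c k * (norm (n k))\<^sup>2" by (simp add: c_def)
        finally have "((D k)\<^sup>2 / a k)\<^sup>2 \<le> c k / \<kappa> * (norm (n k))\<^sup>2"
          using \<kappa> by (simp add: power2_eq_square field_simps)
        also have "c k / \<kappa> = (s k)\<^sup>2" unfolding s_def using c0 \<kappa> by simp
        finally show "((D k)\<^sup>2 / a k)\<^sup>2 \<le> (s k * norm (n k))\<^sup>2" by (simp add: power_mult_distrib)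
      qed (use s0 in simp)
      then have "(D k)\<^sup>2 \<le> s k * (a k * norm (n k))"
        using a(1)[of k] by (simp add: field_simps)
      also have "\<dots> \<le> s k * (E * D k + \<alpha> 0)" using an s0 by (intro mult_left_mono) auto
      finally have "(D k)\<^sup>2 \<le> s k * (E * D k + \<alpha> 0)" .
      moreover have "0 \<le> (s k * E - D k)\<^sup>2" by simp
      ultimately show ?thesis by (simp add: power2_eq_square algebra_simps)
    qed
    moreover have "(\<lambda>k. (s k)\<^sup>2 * E\<^sup>2 + 2 * s k * \<alpha> 0) \<longlonglongrightarrow> 0"
      by (rule tendsto_eq_intros s_lim refl | simp)+
    ultimately have "(\<lambda>k. (D k)\<^sup>2) \<longlonglongrightarrow> 0"
      using Lim_null_comparison[OF always_eventually, of "\<lambda>k. (D k)\<^sup>2"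
          "\<lambda>k. (s k)\<^sup>2 * E\<^sup>2 + 2 * s k * \<alpha> 0"] by simp
    from tendsto_real_sqrt[OF this] show ?thesis using D0 by simp
  qed
  have xb_lim: "(\<lambda>k. x k - b k) \<longlonglongrightarrow> 0"
    using D_lim unfolding D_def by (rule tendsto_norm_zero_cancel)
  \<comment> \<open>If the step sizes vanish, the last rejected trial point certifies a small residual.\<close>
  have small: "\<exists>k\<ge>K. D k / a k \<le> \<rho>" if \<rho>: "\<rho> > 0" for \<rho> K
  proof (rule ccontr)
    assume "\<not> ?thesis"
    then have big: "\<rho> < D k / a k" if "k \<ge> K" for k using that by (meson not_le)
    have a_lim: "a \<longlonglongrightarrow> 0"
    proof (rule Lim_null_comparison)
      show "eventually (\<lambda>k. norm (a k) \<le> D k / \<rho>) sequentially"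
        unfolding eventually_sequentially
      proof (intro exI[of _ K] allI impI)
        fix k assume "K \<le> k"
        then show "norm (a k) \<le> D k / \<rho>" using big[of k] \<rho> a(1)[of k] by (simp add: field_simps)
      qed
      show "(\<lambda>k. D k / \<rho>) \<longlonglongrightarrow> 0" by (rule tendsto_divide_zero[OF D_lim])
    qed
    \<comment> \<open>The threshold is chosen backwards: with the last rejected step
      \<open>a' = a k / \<theta>\<close>, its failure and \<open>norm_fb_step_mono\<close> bound
      \<open>\<delta> * D k\<close> by \<open>a' * e\<close>, so
      \<open>e < \<rho> * \<delta> * \<theta>\<close> yields a residual below
      \<open>\<rho>\<close>.\<close>
    obtain \<eta> where \<eta>: "\<eta> > 0" "\<And>u v. norm (u - v) < \<eta> \<Longrightarrow> norm (A2 u - A2 v) < \<rho> * \<delta> * \<theta>"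
      using A2_uc \<rho> delta theta unfolding uniformly_continuous_on_def dist_norm
      by (metis UNIV_I mult_pos_pos)
    \<comment> \<open>In terms of \<open>a'\<close> these are \<open>a' * L / \<delta>\<close> and
      \<open>2 * a' / \<delta>\<close>: a small first one absorbs the linear growth, a small second
      one then gives \<open>q < \<eta>\<close>.\<close>
    have "(\<lambda>k. a k * (L / (\<delta> * \<theta>))) \<longlonglongrightarrow> 0" "(\<lambda>k. a k * (2 / (\<delta> * \<theta>))) \<longlonglongrightarrow> 0"
      using tendsto_mult_left_zero[OF a_lim] by blast+
    then have "eventually (\<lambda>k. a k * (L / (\<delta> * \<theta>)) < 1/2 \<and> a k * (2 / (\<delta> * \<theta>)) < \<eta>) sequentially"
      using \<eta>(1) by (intro eventually_conj order_tendstoD(2)) auto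
    then obtain K' where K': "\<And>k. k \<ge> K' \<Longrightarrow> a k * (L / (\<delta> * \<theta>)) < 1/2 \<and> a k * (2 / (\<delta> * \<theta>)) < \<eta>"
      unfolding eventually_sequentially by blast
    define N where "N = max K K'"
    \<comment> \<open>Positive step sizes tending to 0 cannot be eventually constant, so some late
      iteration has a rejected trial.\<close>
    obtain k where k: "k \<ge> N" "\<alpha> (Suc k) \<noteq> \<alpha> k"
    proof (rule ccontr)
      assume "\<not> thesis"
      with that have eq: "\<And>k. k \<ge> N \<Longrightarrow> \<alpha> (Suc k) = \<alpha> k" by blast
      have "\<alpha> k = \<alpha> N" if "k \<ge> N" for k
        using that by (induction k rule: dec_induct) (auto simp: eq)
      then have "eventually (\<lambda>k. a k = \<alpha> N) sequentially"
        unfolding eventually_sequentially a_def by (meson le_SucI)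
      then have "a \<longlonglongrightarrow> \<alpha> N" by (rule tendsto_eventually)
      from LIMSEQ_unique[OF a_lim this] show False using alpha_pos[of N] by simp
    qed
    define j where "j = (LEAST j. accept k j)"
    have aj: "a k = \<alpha> k * \<theta> ^ j" unfolding a_def j_def alpha_step index ..
    have j: "j \<noteq> 0" using k(2) aj unfolding a_def by (cases j) auto
    define a' where "a' = \<alpha> k * \<theta> ^ (j - 1)"
    have a': "a k = a' * \<theta>" "a' > 0"
      unfolding a'_def aj using j alpha_pos[of k] theta by (cases j; simp)+
    define q where "q = norm (x k - fb a' (x k))"
    define e where "e = norm (A2 (x k) - A2 (fb a' (x k)))"
    have "\<not> accept k (j - 1)" using j unfolding j_def by (intro not_less_Least) simp
    then have "\<delta> * q\<^sup>2 \<le> a' * inner (A2 (x k) - A2 (fb a' (x k))) (x k - fb a' (x k))"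
      unfolding accept_def a'_def q_def by simp
    also have "\<dots> \<le> a' * (e * q)"
      unfolding e_def q_def using a'(2) by (intro mult_left_mono norm_cauchy_schwarz) auto
    finally have q: "\<delta> * q \<le> a' * e"
      unfolding q_def e_def using a'(2)
      by (cases "x k = fb a' (x k)") (simp_all add: power2_eq_square mult.assoc[symmetric])
    have q0: "q \<ge> 0" unfolding q_def by simp
    have a'_small: "a' * L / \<delta> < 1/2" "2 * a' / \<delta> < \<eta>"
      using K'[of k] k(1) theta delta unfolding a'(1) N_def by (auto simp: field_simps)
    have "\<delta> * q \<le> a' * (1 + L * q)"
      using q L(2)[of "x k" "fb a' (x k)"] a'(2) unfolding e_def q_def
      by (meson less_imp_le mult_left_mono order_trans)
    then have "q \<le> a' / \<delta> + (a' * L / \<delta>) * q"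
      using delta by (simp add: field_simps)
    also have "\<dots> \<le> a' / \<delta> + 1/2 * q"
      using a'_small(1) q0 by (intro add_left_mono mult_right_mono) auto
    finally have "q < \<eta>" using a'_small(2) by simp
    then have e: "e < \<rho> * \<delta> * \<theta>" unfolding q_def e_def by (rule \<eta>(2))
    have "D k \<le> q"
      unfolding D_def b_def q_def using a'(2) a(1)[of k] theta unfolding a'(1)
      by (intro norm_fb_step_mono) (auto simp: mult_left_le)
    then have "\<delta> * D k \<le> a' * e" using q delta by (meson less_imp_le mult_left_mono order_trans)
    also have "\<dots> < a' * (\<rho> * \<delta> * \<theta>)" using e a'(2) by simp
    finally have "D k / a k < \<rho>" using a' theta delta by (simp add: field_simps)
    then show False using big[of k] k(1) unfolding N_def by simp
  qed

  \<comment> \<open>Tracking late iterates by a proximal trajectory\<close>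
  have approx: "eventually (\<lambda>k. \<exists>y. \<exists>v\<in>AB y. norm v \<le> \<rho>' \<and> norm (x k - y) \<le> \<rho>') sequentially"
    if \<rho>': "\<rho>' > 0" for \<rho>'
  proof -
    define \<rho> where "\<rho> = \<rho>' / 2"
    have \<rho>: "\<rho> > 0" using \<rho>' unfolding \<rho>_def by simp
    have "(\<lambda>k. norm (A (x k) - A (b k))) \<longlonglongrightarrow> 0"
      by (intro tendsto_norm_zero uniformly_continuous_diff_tendsto_zero[OF A_uc xb_lim])
    moreover have "(\<lambda>k. norm (x (Suc k) - x k) + D k) \<longlonglongrightarrow> 0"
      using tendsto_add[OF move_lim D_lim] by simp
    ultimately have "eventually (\<lambda>k. norm (A (x k) - A (b k)) < \<rho>
        \<and> norm (x (Suc k) - x k) + D k < \<rho>) sequentially"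
      using \<rho> by (intro eventually_conj order_tendstoD(2)) auto
    then obtain K1 where K1: "\<And>k. k \<ge> K1 \<Longrightarrow> norm (A (x k) - A (b k)) < \<rho>"
      "\<And>k. k \<ge> K1 \<Longrightarrow> norm (x (Suc k) - x k) + D k < \<rho>"
      unfolding eventually_sequentially by blast
    \<comment> \<open>The accumulated error, four times a tail sum, stays below
      \<open>\<rho>^2\<close>; together with the initial \<open>\<rho>^2\<close> the squared
      distance remains below \<open>(2 * \<rho>)^2\<close>.\<close>
    obtain K2 where K2: "\<And>m k. m \<ge> K2 \<Longrightarrow> norm (sum c {m..<k}) < \<rho>\<^sup>2 / 4"
      using c_sum \<rho> unfolding summable_Cauchy by (metis divide_pos_pos zero_less_numeral zero_less_power)
    obtain K where K: "K \<ge> max K1 K2" "D K / a K \<le> \<rho>" using small[OF \<rho>] by blast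
    \<comment> \<open>The restart value \<open>v\<close> has norm at most \<open>2 * \<rho>\<close>:
      one \<open>\<rho>\<close> from the residual, one from \<open>A (x k) - A (b k)\<close>. Hence
      \<open>\<rho>\<close> is half of \<open>\<rho>'\<close>.\<close>
    have reset: "\<exists>v\<in>AB (b k). norm v \<le> 2 * \<rho> \<and> (norm (x (Suc k) - b k))\<^sup>2 \<le> \<rho>\<^sup>2"
      if k: "k \<ge> K" "D k / a k \<le> \<rho>" for k
    proof -
      define v where "v = (1 / a k) *\<^sub>R (x k - b k) - A (x k) + A (b k)"
      have "v \<in> AB (b k)" unfolding v_def b_def by (rule fb_residual[OF a(1)])
      moreover have "norm v \<le> 2 * \<rho>"
      proof -
        have "norm v \<le> norm ((1 / a k) *\<^sub>R (x k - b k)) + norm (A (x k) - A (b k))"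
          unfolding v_def using norm_triangle_ineq4[of "(1 / a k) *\<^sub>R (x k - b k)" "A (x k) - A (b k)"]
          by (simp add: algebra_simps)
        also have "norm ((1 / a k) *\<^sub>R (x k - b k)) = D k / a k"
          unfolding D_def using a(1)[of k] by simp
        finally show ?thesis using k K1(1)[of k] K(1) by simp
      qed
      moreover have "(norm (x (Suc k) - b k))\<^sup>2 \<le> \<rho>\<^sup>2"
      proof (rule power_mono)
        show "norm (x (Suc k) - b k) \<le> \<rho>"
          using norm_triangle_ineq[of "x (Suc k) - x k" "x k - b k"] K1(2)[of k] k K(1)
          unfolding D_def by simp
      qed simp
      ultimately show ?thesis by blast
    qed
    have track: "\<exists>y. \<exists>v\<in>AB y. norm v \<le> 2 * \<rho> \<and> (norm (x (Suc k) - y))\<^sup>2 \<le> \<rho>\<^sup>2 + 4 * sum c {K..<Suc k}"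
      if "k \<ge> K" for k
      using that
    proof (induction k rule: dec_induct)
      case base
      then show ?case using reset[OF order_refl K(2)] c0[of K] by fastforce
    next
      case (step k)
      show ?case
      proof (cases "D (Suc k) / a (Suc k) \<le> \<rho>")
        case True
        have "0 \<le> sum c {K..<Suc (Suc k)}" using c0 by (intro sum_nonneg) auto
        then show ?thesis using reset[of "Suc k"] True step.hyps by fastforce
      next
        \<comment> \<open>A residual above \<open>\<rho>\<close> exceeds half the norm of
          \<open>v'\<close>, so the only harmful term of \<open>descent\<close>, the product with
          \<open>x - b\<close>, is bounded by a multiple of the summable \<open>c\<close>.\<close>
        case False
        obtain y v where y: "v \<in> AB y" "norm v \<le> 2 * \<rho>"
          "(norm (x (Suc k) - y))\<^sup>2 \<le> \<rho>\<^sup>2 + 4 * sum c {K..<Suc k}"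
          using step.IH by blast
        obtain v' where v': "v' \<in> AB (y - l (Suc k) *\<^sub>R v')" "norm v' \<le> norm v"
          using resolvent_step[OF AB_mm l y(1), of "Suc k"] by blast
        have "inner v' (x (Suc k) - b (Suc k)) \<le> norm v' * D (Suc k)"
          unfolding D_def by (rule norm_cauchy_schwarz)
        also have "\<dots> \<le> (2 * (D (Suc k) / a (Suc k))) * D (Suc k)"
          using v'(2) y(2) False by (intro mult_right_mono) (auto simp: D_def)
        finally have "2 * l (Suc k) * inner v' (x (Suc k) - b (Suc k))
            \<le> 2 * l (Suc k) * ((2 * (D (Suc k) / a (Suc k))) * D (Suc k))"
          using l[of "Suc k"] by (intro mult_left_mono) auto
        also have "\<dots> = 4 * c (Suc k)" unfolding c_def by (simp add: power2_eq_square)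
        finally have 1: "2 * l (Suc k) * inner v' (x (Suc k) - b (Suc k)) \<le> 4 * c (Suc k)" .
        have "0 \<le> \<kappa> * c (Suc k)" using \<kappa> c0 by simp
        then have "(norm (x (Suc (Suc k)) - (y - l (Suc k) *\<^sub>R v')))\<^sup>2
            \<le> (norm (x (Suc k) - y))\<^sup>2 + 4 * c (Suc k)"
          using descent[OF v'(1)] 1 unfolding c_def by linarith
        also have "\<dots> \<le> \<rho>\<^sup>2 + 4 * sum c {K..<Suc (Suc k)}" using y(3) step.hyps by simp
        finally show ?thesis using v' y(2) by (meson order_trans)
      qed
    qed
    have "\<exists>y. \<exists>v\<in>AB y. norm v \<le> \<rho>' \<and> norm (x k - y) \<le> \<rho>'" if k: "k \<ge> Suc K" for k
    proof -
      obtain k' where k': "k = Suc k'" "k' \<ge> K" using k by (cases k) auto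
      obtain y v where y: "v \<in> AB y" "norm v \<le> 2 * \<rho>"
        "(norm (x k - y))\<^sup>2 \<le> \<rho>\<^sup>2 + 4 * sum c {K..<Suc k'}"
        using track[OF k'(2)] unfolding k'(1) by blast
      have "(norm (x k - y))\<^sup>2 \<le> (2 * \<rho>)\<^sup>2"
        using y(3) K2[of K "Suc k'"] K(1) by (simp add: power_mult_distrib)
      then have "norm (x k - y) \<le> 2 * \<rho>" by (rule power2_le_imp_le) (use \<rho> in simp)
      then show ?thesis using y unfolding \<rho>_def by auto
    qed
    then show ?thesis unfolding eventually_sequentially by blast
  qed
  show ?thesis
    by (rule weakly_converges_if_asymptotic_zeros[OF AB_mm zer_ne fejer approx])
qed

end
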